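(* Let $\mathcal R$ and $\mathcal V$ be semi-analytic monads and let $\tau:\mathcal R\to\mathcal V$ be an arbitrary morphism of monads on $\mathbf{Set}$ (a natural transformation compatible with units and multiplications). Then $\tau$ is semi-cartesian if and only if the induced functor $\mathcal{EM}(\tau):\mathcal{EM}(\mathcal V)\to\mathcal{EM}(\mathcal R)$ between categories of algebras preserves Płonka sums (indexed by the categories of regular polynomials over sup-semilattices).
   Context: Semi-analytic monads. Let $\omega=\{0,1,2,\dots\}$, $(n]=\{1,\dots,n\}$, and let $\mathbb S$ be the category with objects $(n]$, $n\in\omega$, and all surjections as morphisms. For $R:\mathbb S\to\mathbf{Set}$ write $R_n=R((n])$. A semi-analytic functor is a finitary endofunctor of $\mathbf{Set}$ preserving pullbacks along monos; equivalently, it is isomorphic to $$\mathcal R(X)=\sum_{n\in\omega}\mathrm{Inj}((n],X)\otimes_nR_n$$ for some $R:\mathbb S\to\mathbf{Set}$, where $\otimes_n$ is the quotient of the product by $\langle\vec x\circ\sigma,r\rangle\sim\langle\vec x,R(\sigma)(r)\rangle$, $\sigma\in S_n$. The class of $\langle \vec x,r\rangle$ is $[\vec x,r]$, and $\mathcal R(f)([\vec x,r])=[\vec y,R(s)(r)]$, where $f\circ\vec x=\vec y\circ s$ with $s:(n]\to(k]$ surjective and $\vec y$ injective. For an arbitrary function $\vec x:(n]\to X$ and $r\in R_n$ put $\langle\!\langle\vec x,r\rangle\!\rangle=\mathcal R(\vec x)([1_{(n]},r])$. A natural transformation is semi-cartesian if its naturality squares at injections are pullbacks. A semi-analytic monad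 is a monad on $\mathbf{Set}$ with semi-analytic functor part and semi-cartesian unit and multiplication. $\mathcal{EM}(\mathcal R)$ is the Eilenberg-Moore category, and $\mathcal{EM}(\tau)$ sends $(B,\beta)$ to $(B,\beta\circ\tau_B)$. The terminal semi-analytic monad is the finite power-set monad $\mathcal L$, whose algebras are sup-semilattices (posets with all finite joins, including the bottom element); its coefficient functor is constantly a one-element set. Płonka sums in this statement are those induced by the unique semi-cartesian monad morphisms from $\mathcal R$ and $\mathcal V$ to $\mathcal L$. Explicitly: Category of regular polynomials of a sup-semilattice $A$. $\mathbf A=CP_r(A)$ has the elements of $A$ as objects; a morphism $u\to v$ is a pair $(U,u)$ with $U\subseteq A$ finite, $u\in U$ and $\bigvee U=v$; the identity of $u$ is $(\{u\},u)$; the composite of $(U,u):u\to v$ followed by $(U',v):v\to w$ is $(U\cup(U'\setminus\{v\}),u):u\to w$. The transformation $\lambda^{\mathcal R}$. For a functor $F:\mathbf A\to\mathbf{Set}$ and $[\vec x,r]\in\mathcal R(\coprod_{a\in A}F(a))$, $r\in R_n$, let $p:\coprod_{a\in A}F(a)\to A$ be the projection to the index set, $U=\{p(\vec x(i)):i\in(n]\}$, $b=\bigvee U$ and $\psi_i=(U,p(\vec x(i))):p(\vec x(i))\to b$. Then $$\lambda^{\mathcal R}_F([\vec x,r])=\langle\!\langle\,i\mapsto F(\psi_i)(\vec x(i)),\ r\,\rangle\!\rangle\in\mathcal R(F(b))\subseteq\coprod_{a\in A}\mathcal R(F(a)).$$ $\lambda^{\mathcal V}$ is defined in the same way. The Płonka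 sum of a functor $\mathbf F:\mathbf A\to\mathcal{EM}(\mathcal R)$, $\mathbf F(a)=(F(a),\xi_a)$, is the set $\coprod_{a\in A}F(a)$ with structure map $(\coprod_a\xi_a)\circ\lambda^{\mathcal R}_F$; similarly for $\mathcal V$. Preservation. $\mathcal{EM}(\tau)$ preserves Płonka sums if for every sup-semilattice $A$ and every functor $\mathbf F:CP_r(A)\to\mathcal{EM}(\mathcal V)$, $\mathbf F(a)=(F(a),\xi_a)$, the Płonka sum of $\mathcal{EM}(\tau)\circ\mathbf F$ and the image under $\mathcal{EM}(\tau)$ of the Płonka sum of $\mathbf F$ carry the same $\mathcal R$-structure on $\coprod_aF(a)$, i.e. $$\Big(\coprod_a\xi_a\Big)\circ\Big(\coprod_a\tau_{F(a)}\Big)\circ\lambda^{\mathcal R}_F=\Big(\coprod_a\xi_a\Big)\circ\lambda^{\mathcal V}_F\circ\tau_{\coprod_aF(a)} .$$ *)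

theory Defs
  imports "HOL-Library.FuncSet" "HOL-Algebra.Lattice"
begin

section \<open>The category of sets\<close>

text \<open>
  HOL has no type of all sets, so \<open>Set\<close> is the category of \<open>\<U>\<close>-small sets, for an arbitrary
  universe \<open>\<U>\<close> of subsets of a type \<open>'u\<close> and an injective pairing \<open>pr\<close> of elements, which serves
  to form coproducts. Closure under power sets is not required: every Grothendieck universe is an
  instance, and so is \<open>\<U> = UNIV\<close> for any infinite type \<open>'u\<close>. Morphisms \<open>X \<rightarrow> Y\<close> are the extensional
  functions in \<open>X \<rightarrow>\<^sub>E Y\<close>, composed by \<^const>\<open>compose\<close>, so that they are equal iff they agree
  on \<open>X\<close>.
\<close>

locale set_universe =
  fixes \<U> :: "'u set set" and pr :: "'u \<times> 'u \<Rightarrow> 'u"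
  assumes subset_closed: "X \<in> \<U> \<Longrightarrow> Y \<subseteq> X \<Longrightarrow> Y \<in> \<U>"
    and image_closed: "X \<in> \<U> \<Longrightarrow> f ` X \<in> \<U>"
    and Union_closed: "I \<in> \<U> \<Longrightarrow> (\<And>i. i \<in> I \<Longrightarrow> F i \<in> \<U>) \<Longrightarrow> (\<Union>i\<in>I. F i) \<in> \<U>"
    and infinity: "\<exists>X\<in>\<U>. infinite X"
    and inj_pr: "inj pr"

abbreviation id_on :: "'a set \<Rightarrow> 'a \<Rightarrow> 'a" where
  "id_on X \<equiv> (\<lambda>x\<in>X. x)"

definition is_pullback ::
    "'u set set \<Rightarrow> 'u set \<Rightarrow> 'u set \<Rightarrow> 'u set \<Rightarrow> 'u set \<Rightarrow>
     ('u \<Rightarrow> 'u) \<Rightarrow> ('u \<Rightarrow> 'u) \<Rightarrow> ('u \<Rightarrow> 'u) \<Rightarrow> ('u \<Rightarrow> 'u) \<Rightarrow> bool" where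
  "is_pullback \<U> P A B C p q f g \<longleftrightarrow>
     p \<in> P \<rightarrow>\<^sub>E A \<and> q \<in> P \<rightarrow>\<^sub>E B \<and> f \<in> A \<rightarrow>\<^sub>E C \<and> g \<in> B \<rightarrow>\<^sub>E C \<and>
     compose P f p = compose P g q \<and>
     (\<forall>W\<in>\<U>. \<forall>h \<in> W \<rightarrow>\<^sub>E A. \<forall>k \<in> W \<rightarrow>\<^sub>E B. compose W f h = compose W g k \<longrightarrow>
        (\<exists>!m. m \<in> W \<rightarrow>\<^sub>E P \<and> compose W p m = h \<and> compose W q m = k))"

definition coprod :: "('u \<times> 'u \<Rightarrow> 'u) \<Rightarrow> 'u set \<Rightarrow> ('u \<Rightarrow> 'u set) \<Rightarrow> 'u set" where
  "coprod pr I F = pr ` (SIGMA a:I. F a)"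

definition coprod_map ::
    "('u \<times> 'u \<Rightarrow> 'u) \<Rightarrow> 'u set \<Rightarrow> ('u \<Rightarrow> 'u set) \<Rightarrow> ('u \<Rightarrow> 'u \<Rightarrow> 'u) \<Rightarrow> 'u \<Rightarrow> 'u" where
  "coprod_map pr I F g = (\<lambda>w\<in>coprod pr I F. case inv pr w of (a, z) \<Rightarrow> pr (a, g a z))"


section \<open>Endofunctors, natural transformations and monads\<close>

text \<open>\<open>ar F X Y f\<close> is the value of \<open>F\<close> on \<open>f : X \<rightarrow> Y\<close>.\<close>

record 'u endofun =
  ob :: "'u set \<Rightarrow> 'u set"
  ar :: "'u set \<Rightarrow> 'u set \<Rightarrow> ('u \<Rightarrow> 'u) \<Rightarrow> 'u \<Rightarrow> 'u"

record 'u monad = "'u endofun" +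
  eta :: "'u set \<Rightarrow> 'u \<Rightarrow> 'u"
  mu :: "'u set \<Rightarrow> 'u \<Rightarrow> 'u"

definition endofunctor :: "'u set set \<Rightarrow> ('u, 'm) endofun_scheme \<Rightarrow> bool" where
  "endofunctor \<U> F \<longleftrightarrow>
     (\<forall>X\<in>\<U>. ob F X \<in> \<U>) \<and>
     (\<forall>X\<in>\<U>. \<forall>Y\<in>\<U>. \<forall>f \<in> X \<rightarrow>\<^sub>E Y. ar F X Y f \<in> ob F X \<rightarrow>\<^sub>E ob F Y) \<and>
     (\<forall>X\<in>\<U>. ar F X X (id_on X) = id_on (ob F X)) \<and>
     (\<forall>X\<in>\<U>. \<forall>Y\<in>\<U>. \<forall>Z\<in>\<U>. \<forall>f \<in> X \<rightarrow>\<^sub>E Y. \<forall>g \<in> Y \<rightarrow>\<^sub>E Z.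
        ar F X Z (compose X g f) = compose (ob F X) (ar F Y Z g) (ar F X Y f))"

definition id_fun :: "'u endofun" where
  "id_fun = \<lparr>ob = (\<lambda>X. X), ar = (\<lambda>X Y f. f)\<rparr>"

definition comp_fun :: "('u, 'm) endofun_scheme \<Rightarrow> ('u, 'n) endofun_scheme \<Rightarrow> 'u endofun" where
  "comp_fun G F = \<lparr>ob = (\<lambda>X. ob G (ob F X)),
                   ar = (\<lambda>X Y f. ar G (ob F X) (ob F Y) (ar F X Y f))\<rparr>"

definition nat_trans ::
    "'u set set \<Rightarrow> ('u, 'm) endofun_scheme \<Rightarrow> ('u, 'n) endofun_scheme \<Rightarrow>
     ('u set \<Rightarrow> 'u \<Rightarrow> 'u) \<Rightarrow> bool" where
  "nat_trans \<U> F G \<alpha> \<longleftrightarrow>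
     (\<forall>X\<in>\<U>. \<alpha> X \<in> ob F X \<rightarrow>\<^sub>E ob G X) \<and>
     (\<forall>X\<in>\<U>. \<forall>Y\<in>\<U>. \<forall>f \<in> X \<rightarrow>\<^sub>E Y.
        compose (ob F X) (ar G X Y f) (\<alpha> X) = compose (ob F X) (\<alpha> Y) (ar F X Y f))"

definition semi_cartesian ::
    "'u set set \<Rightarrow> ('u, 'm) endofun_scheme \<Rightarrow> ('u, 'n) endofun_scheme \<Rightarrow>
     ('u set \<Rightarrow> 'u \<Rightarrow> 'u) \<Rightarrow> bool" where
  "semi_cartesian \<U> F G \<alpha> \<longleftrightarrow> nat_trans \<U> F G \<alpha> \<and>
     (\<forall>X\<in>\<U>. \<forall>Y\<in>\<U>. \<forall>f \<in> X \<rightarrow>\<^sub>E Y. inj_on f X \<longrightarrow>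
        is_pullback \<U> (ob F X) (ob F Y) (ob G X) (ob G Y)
          (ar F X Y f) (\<alpha> X) (\<alpha> Y) (ar G X Y f))"

definition is_monad :: "'u set set \<Rightarrow> ('u, 'm) monad_scheme \<Rightarrow> bool" where
  "is_monad \<U> T \<longleftrightarrow>
     endofunctor \<U> T \<and>
     nat_trans \<U> id_fun T (eta T) \<and>
     nat_trans \<U> (comp_fun T T) T (mu T) \<and>
     (\<forall>X\<in>\<U>.
        compose (ob T X) (mu T X) (eta T (ob T X)) = id_on (ob T X) \<and>
        compose (ob T X) (mu T X) (ar T X (ob T X) (eta T X)) = id_on (ob T X) \<and>
        compose (ob T (ob T (ob T X))) (mu T X) (mu T (ob T X)) =
        compose (ob T (ob T (ob T X))) (mu T X) (ar T (ob T (ob T X)) (ob T X) (mu T X)))"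

definition monad_morphism ::
    "'u set set \<Rightarrow> ('u, 'm) monad_scheme \<Rightarrow> ('u, 'n) monad_scheme \<Rightarrow>
     ('u set \<Rightarrow> 'u \<Rightarrow> 'u) \<Rightarrow> bool" where
  "monad_morphism \<U> R V \<tau> \<longleftrightarrow>
     nat_trans \<U> R V \<tau> \<and>
     (\<forall>X\<in>\<U>.
        compose X (\<tau> X) (eta R X) = eta V X \<and>
        compose (ob R (ob R X)) (\<tau> X) (mu R X) =
        compose (ob R (ob R X)) (mu V X)
          (compose (ob R (ob R X)) (\<tau> (ob V X)) (ar R (ob R X) (ob V X) (\<tau> X))))"


section \<open>Semi-analytic functors and monads\<close>

definition surj_hom :: "nat \<Rightarrow> nat \<Rightarrow> (nat \<Rightarrow> nat) set" where
  "surj_hom n m = {s \<in> {1..n} \<rightarrow>\<^sub>E {1..m}. s ` {1..n} = {1..m}}"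

text \<open>Functors from the category of the sets \<open>{1..n}\<close> and surjections to \<open>Set\<close>.\<close>

record 'u coeff =
  cob :: "nat \<Rightarrow> 'u set"
  car :: "nat \<Rightarrow> nat \<Rightarrow> (nat \<Rightarrow> nat) \<Rightarrow> 'u \<Rightarrow> 'u"

definition coeff_functor :: "'u set set \<Rightarrow> 'u coeff \<Rightarrow> bool" where
  "coeff_functor \<U> C \<longleftrightarrow>
     (\<forall>n. cob C n \<in> \<U>) \<and>
     (\<forall>n m. \<forall>s \<in> surj_hom n m. car C n m s \<in> cob C n \<rightarrow>\<^sub>E cob C m) \<and>
     (\<forall>n. car C n n (id_on {1..n}) = id_on (cob C n)) \<and>
     (\<forall>n m k. \<forall>s \<in> surj_hom n m. \<forall>t \<in> surj_hom m k.
        car C n k (compose {1..n} t s) = compose (cob C n) (car C m k t) (car C n m s))"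

text \<open>
  \<open>sa_ob C X\<close> is the sum over \<open>n\<close> of the quotients of \<open>Inj({1..n}, X) \<times> C\<^sub>n\<close> by the action of the
  symmetric group. It is defined for \<open>X\<close> of any type because it is also needed at
  \<open>X = {1..n} \<subseteq> \<nat>\<close>.
\<close>

type_synonym ('a, 'u) sa_rep = "nat \<times> (nat \<Rightarrow> 'a) \<times> 'u"

definition sa_pre :: "'u coeff \<Rightarrow> 'a set \<Rightarrow> ('a, 'u) sa_rep set" where
  "sa_pre C X = {(n, x, r). x \<in> {1..n} \<rightarrow>\<^sub>E X \<and> inj_on x {1..n} \<and> r \<in> cob C n}"

definition sa_rel :: "'u coeff \<Rightarrow> 'a set \<Rightarrow> (('a, 'u) sa_rep \<times> ('a, 'u) sa_rep) set" where
  "sa_rel C X = {((n, compose {1..n} x \<sigma>, r), (n, x, car C n n \<sigma> r)) | n x r \<sigma>.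
     (n, x, r) \<in> sa_pre C X \<and> \<sigma> \<in> {1..n} \<rightarrow>\<^sub>E {1..n} \<and> bij_betw \<sigma> {1..n} {1..n}}"

definition sa_ob :: "'u coeff \<Rightarrow> 'a set \<Rightarrow> ('a, 'u) sa_rep set set" where
  "sa_ob C X = sa_pre C X // sa_rel C X"

definition sa_cls :: "'u coeff \<Rightarrow> 'a set \<Rightarrow> nat \<Rightarrow> (nat \<Rightarrow> 'a) \<Rightarrow> 'u \<Rightarrow> ('a, 'u) sa_rep set" where
  "sa_cls C X n x r = sa_rel C X `` {(n, x, r)}"

definition sa_ar ::
    "'u coeff \<Rightarrow> 'a set \<Rightarrow> 'b set \<Rightarrow> ('a \<Rightarrow> 'b) \<Rightarrow> ('a, 'u) sa_rep set \<Rightarrow> ('b, 'u) sa_rep set" where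
  "sa_ar C X Y f = (\<lambda>c\<in>sa_ob C X. THE d. \<exists>n x r k s y.
     (n, x, r) \<in> c \<and> s \<in> surj_hom n k \<and> y \<in> {1..k} \<rightarrow>\<^sub>E Y \<and> inj_on y {1..k} \<and>
     compose {1..n} f x = compose {1..n} y s \<and> d = sa_cls C Y k y (car C n k s r))"

definition sa_presentation ::
    "'u set set \<Rightarrow> ('u, 'm) endofun_scheme \<Rightarrow> 'u coeff \<Rightarrow>
     ('u set \<Rightarrow> ('u, 'u) sa_rep set \<Rightarrow> 'u) \<Rightarrow> bool" where
  "sa_presentation \<U> T C \<phi> \<longleftrightarrow>
     coeff_functor \<U> C \<and>
     (\<forall>X\<in>\<U>. bij_betw (\<phi> X) (sa_ob C X) (ob T X)) \<and>
     (\<forall>X\<in>\<U>. \<forall>Y\<in>\<U>. \<forall>f \<in> X \<rightarrow>\<^sub>E Y. \<forall>c \<in> sa_ob C X.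
        ar T X Y f (\<phi> X c) = \<phi> Y (sa_ar C X Y f c))"

text \<open>
  A semi-analytic monad is equipped here with a chosen natural isomorphism \<open>\<phi>\<close> of its functor part
  with the functor given by coefficients \<open>C\<close>.
\<close>

definition semi_analytic_monad ::
    "'u set set \<Rightarrow> ('u, 'm) monad_scheme \<Rightarrow> 'u coeff \<Rightarrow>
     ('u set \<Rightarrow> ('u, 'u) sa_rep set \<Rightarrow> 'u) \<Rightarrow> bool" where
  "semi_analytic_monad \<U> T C \<phi> \<longleftrightarrow>
     is_monad \<U> T \<and> sa_presentation \<U> T C \<phi> \<and>
     semi_cartesian \<U> id_fun T (eta T) \<and> semi_cartesian \<U> (comp_fun T T) T (mu T)"

text \<open>
  The element \<open>\<langle>\<langle>x, r\<rangle>\<rangle>\<close> of \<open>T X\<close>, for \<open>x : {1..n} \<rightarrow> X\<close> not necessarily injective: the image of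
  \<open>[id, r]\<close> under \<open>x\<close>, transported along \<open>\<phi>\<close>.
\<close>

definition sa_elem ::
    "'u coeff \<Rightarrow> ('u set \<Rightarrow> ('u, 'u) sa_rep set \<Rightarrow> 'u) \<Rightarrow> 'u set \<Rightarrow> nat \<Rightarrow> (nat \<Rightarrow> 'u) \<Rightarrow> 'u \<Rightarrow> 'u"
  where
  "sa_elem C \<phi> X n x r = \<phi> X (sa_ar C {1..n} X x (sa_cls C {1..n} n (id_on {1..n}) r))"


section \<open>Eilenberg-Moore algebras\<close>

type_synonym 'u alg = "'u set \<times> ('u \<Rightarrow> 'u)"

definition em_algebra :: "'u set set \<Rightarrow> ('u, 'm) monad_scheme \<Rightarrow> 'u alg \<Rightarrow> bool" where
  "em_algebra \<U> T \<A> \<longleftrightarrow> (case \<A> of (B, \<beta>) \<Rightarrow>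
     B \<in> \<U> \<and> \<beta> \<in> ob T B \<rightarrow>\<^sub>E B \<and>
     compose B \<beta> (eta T B) = id_on B \<and>
     compose (ob T (ob T B)) \<beta> (mu T B) = compose (ob T (ob T B)) \<beta> (ar T (ob T B) B \<beta>))"

definition em_hom :: "('u, 'm) monad_scheme \<Rightarrow> 'u alg \<Rightarrow> 'u alg \<Rightarrow> ('u \<Rightarrow> 'u) set" where
  "em_hom T \<A> \<B> = (case (\<A>, \<B>) of ((A, \<alpha>), (B, \<beta>)) \<Rightarrow>
     {h \<in> A \<rightarrow>\<^sub>E B. compose (ob T A) h \<alpha> = compose (ob T A) \<beta> (ar T A B h)})"

text \<open>The object part of \<open>EM(\<tau>)\<close>; on morphisms \<open>EM(\<tau>)\<close> is the identity.\<close>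

definition em_map :: "('u, 'm) monad_scheme \<Rightarrow> ('u set \<Rightarrow> 'u \<Rightarrow> 'u) \<Rightarrow> 'u alg \<Rightarrow> 'u alg" where
  "em_map R \<tau> \<A> = (case \<A> of (B, \<beta>) \<Rightarrow> (B, compose (ob R B) \<beta> (\<tau> B)))"


section \<open>Sup-semilattices and their regular polynomials\<close>

definition sup_semilattice :: "('a, 'm) gorder_scheme \<Rightarrow> bool" where
  "sup_semilattice L \<longleftrightarrow> partial_order L \<and>
     (\<forall>U. U \<subseteq> carrier L \<and> finite U \<longrightarrow> (\<exists>s. least L s (Upper L U)))"

definition cpr_hom :: "('a, 'm) gorder_scheme \<Rightarrow> 'a \<Rightarrow> 'a \<Rightarrow> ('a set \<times> 'a) set" where
  "cpr_hom L u v = {(U, u) | U. U \<subseteq> carrier L \<and> finite U \<and> u \<in> U \<and> \<Squnion>\<^bsub>L\<^esub>U = v}"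

definition cpr_id :: "'a \<Rightarrow> 'a set \<times> 'a" where
  "cpr_id u = ({u}, u)"

text \<open>\<open>cpr_comp (U', v) (U, u)\<close> is \<open>(U, u) : u \<rightarrow> v\<close> followed by \<open>(U', v) : v \<rightarrow> w\<close>.\<close>

fun cpr_comp :: "'a set \<times> 'a \<Rightarrow> 'a set \<times> 'a \<Rightarrow> 'a set \<times> 'a" where
  "cpr_comp (U', v) (U, u) = (U \<union> (U' - {v}), u)"

text \<open>Functors \<open>(F, M)\<close> to the category of \<open>T\<close>-algebras, \<open>F\<close> on objects and \<open>M\<close> on morphisms.\<close>

definition cpr_alg_functor ::
    "'u set set \<Rightarrow> ('u, 'm) monad_scheme \<Rightarrow> 'u gorder \<Rightarrow>
     ('u \<Rightarrow> 'u alg) \<Rightarrow> ('u set \<times> 'u \<Rightarrow> 'u \<Rightarrow> 'u) \<Rightarrow> bool" where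
  "cpr_alg_functor \<U> T L F M \<longleftrightarrow>
     (\<forall>a \<in> carrier L. em_algebra \<U> T (F a)) \<and>
     (\<forall>u \<in> carrier L. \<forall>v \<in> carrier L. \<forall>f \<in> cpr_hom L u v. M f \<in> em_hom T (F u) (F v)) \<and>
     (\<forall>u \<in> carrier L. M (cpr_id u) = id_on (fst (F u))) \<and>
     (\<forall>u \<in> carrier L. \<forall>v \<in> carrier L. \<forall>w \<in> carrier L.
        \<forall>f \<in> cpr_hom L u v. \<forall>g \<in> cpr_hom L v w.
          M (cpr_comp g f) = compose (fst (F u)) (M g) (M f))"


section \<open>Plonka sums\<close>

text \<open>
  \<open>plonka_lambda pr T C \<phi> L F M\<close> is \<open>\<lambda>\<close> from \<open>T (\<Coprod>\<^sub>a F a)\<close> to \<open>\<Coprod>\<^sub>a T (F a)\<close> at the set-valued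
  functor \<open>(F, M)\<close>. An element of a coproduct is \<open>pr (a, z)\<close>, so \<open>fst (inv pr w)\<close> is its index.
\<close>

definition plonka_lambda ::
    "('u \<times> 'u \<Rightarrow> 'u) \<Rightarrow> ('u, 'm) monad_scheme \<Rightarrow> 'u coeff \<Rightarrow>
     ('u set \<Rightarrow> ('u, 'u) sa_rep set \<Rightarrow> 'u) \<Rightarrow> 'u gorder \<Rightarrow>
     ('u \<Rightarrow> 'u set) \<Rightarrow> ('u set \<times> 'u \<Rightarrow> 'u \<Rightarrow> 'u) \<Rightarrow> 'u \<Rightarrow> 'u" where
  "plonka_lambda pr T C \<phi> L F M =
     (let S = coprod pr (carrier L) F in
      (\<lambda>t\<in>ob T S. THE w. \<exists>n x r. (n, x, r) \<in> sa_pre C S \<and> t = \<phi> S (sa_cls C S n x r) \<and>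
        (let p = (\<lambda>i. fst (inv pr (x i)));
             z = (\<lambda>i. snd (inv pr (x i)));
             U = p ` {1..n};
             b = \<Squnion>\<^bsub>L\<^esub>U
         in w = pr (b, sa_elem C \<phi> (F b) n (\<lambda>i\<in>{1..n}. M (U, p i) (z i)) r))))"

definition plonka_sum ::
    "('u \<times> 'u \<Rightarrow> 'u) \<Rightarrow> ('u, 'm) monad_scheme \<Rightarrow> 'u coeff \<Rightarrow>
     ('u set \<Rightarrow> ('u, 'u) sa_rep set \<Rightarrow> 'u) \<Rightarrow> 'u gorder \<Rightarrow>
     ('u \<Rightarrow> 'u alg) \<Rightarrow> ('u set \<times> 'u \<Rightarrow> 'u \<Rightarrow> 'u) \<Rightarrow> 'u alg" where
  "plonka_sum pr T C \<phi> L F M =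
     (let S = coprod pr (carrier L) (\<lambda>a. fst (F a)) in
      (S, compose (ob T S)
            (coprod_map pr (carrier L) (\<lambda>a. ob T (fst (F a))) (\<lambda>a. snd (F a)))
            (plonka_lambda pr T C \<phi> L (\<lambda>a. fst (F a)) M)))"

definition preserves_plonka_sums ::
    "'u set set \<Rightarrow> ('u \<times> 'u \<Rightarrow> 'u) \<Rightarrow>
     ('u, 'm) monad_scheme \<Rightarrow> 'u coeff \<Rightarrow> ('u set \<Rightarrow> ('u, 'u) sa_rep set \<Rightarrow> 'u) \<Rightarrow>
     ('u, 'n) monad_scheme \<Rightarrow> 'u coeff \<Rightarrow> ('u set \<Rightarrow> ('u, 'u) sa_rep set \<Rightarrow> 'u) \<Rightarrow>
     ('u set \<Rightarrow> 'u \<Rightarrow> 'u) \<Rightarrow> bool" where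
  "preserves_plonka_sums \<U> pr R CR \<phi>R V CV \<phi>V \<tau> \<longleftrightarrow>
     (\<forall>L F M. sup_semilattice L \<and> carrier L \<in> \<U> \<and> cpr_alg_functor \<U> V L F M \<longrightarrow>
        plonka_sum pr R CR \<phi>R L (\<lambda>a. em_map R \<tau> (F a)) M =
        em_map R \<tau> (plonka_sum pr V CV \<phi>V L F M))"

end

theory Submission
  imports Defs
begin

text \<open>
  The proof compares both sides of the equivalence with a condition on supports. The support of
  \<open>[x, r] \<in> T X\<close> is the image of the injection \<open>x\<close>, that is, the smallest
  \<open>Z \<subseteq> X\<close> such that the element comes from \<open>T Z\<close>. For a map \<open>f\<close>, the support of
  \<open>T f t\<close> is the image under \<open>f\<close> of the support of \<open>t\<close>; for an injection \<open>f : X \<rightarrow> Y\<close>,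
  \<open>T f\<close> is injective and its image consists of the elements supported in \<open>f(X)\<close>. It follows by
  naturality at the inclusion of a support that a transformation \<open>\<tau>\<close> can only shrink supports, and
  the naturality square at an injection \<open>f\<close> is a pullback iff \<open>t\<close> is supported in \<open>f(X)\<close>
  whenever \<open>\<tau> t\<close> is. Hence \<open>\<tau>\<close> is semi-cartesian iff it preserves supports
  (\<open>semi_cartesian_supp_tau\<close>, \<open>supp_tau_semi_cartesian\<close>).

  For Plonka sums, let \<open>t \<in> T (\<Coprod>\<^sub>a F a)\<close> have support \<open>Z\<close>, let \<open>t0 \<in> T Z\<close> be the element from
  which \<open>t\<close> comes, \<open>U\<close> the set of indices of the elements of \<open>Z\<close>, and \<open>b\<close> the join of
  \<open>U\<close>. Then \<open>\<lambda> t\<close> is the element \<open>T h t0\<close> of the summand with index \<open>b\<close>, where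
  \<open>h : Z \<rightarrow> F b\<close> sends \<open>\<langle>a, z\<rangle>\<close> to \<open>F(U, a)(z)\<close> (\<open>plonka_lambda_eq\<close>). So \<open>\<lambda>\<close>
  depends on the presentation only through supports.

  If \<open>\<tau>\<close> preserves supports, then \<open>t\<close> and \<open>\<tau> t\<close> have the same \<open>Z\<close>, \<open>b\<close> and \<open>h\<close>, and
  naturality of \<open>\<tau>\<close> at \<open>h\<close> yields preservation of Plonka sums. Conversely, let \<open>z\<close> lie in
  the support of \<open>t\<close> but not in that of \<open>\<tau> t\<close>. Consider the constant functor at the one-point
  algebra over the chain \<open>a0 < a1\<close>. Its Plonka sum is the chain itself, and the structure map
  sends an element to the join of its support. Renaming \<open>z\<close> to \<open>a1\<close> and every other
  element to \<open>a0\<close> gives an element on which the two structures take the values \<open>a1\<close> and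
  \<open>a0\<close>.
\<close>


section \<open>The functor given by a coefficient functor\<close>

lemma compose_id_on: "g \<in> extensional A \<Longrightarrow> compose A g (id_on A) = g"
  by (auto simp: compose_def extensional_def fun_eq_iff)

lemma surj_hom_self_inj:
  assumes "\<sigma> \<in> surj_hom n n"
  shows "inj_on \<sigma> {1..n}"
  using assms by (intro eq_card_imp_inj_on) (auto simp: surj_hom_def)

lemma surj_hom_self_iff:
  "\<sigma> \<in> surj_hom n n \<longleftrightarrow> \<sigma> \<in> {1..n} \<rightarrow>\<^sub>E {1..n} \<and> bij_betw \<sigma> {1..n} {1..n}"
  using surj_hom_self_inj[of \<sigma> n] by (auto simp: bij_betw_def surj_hom_def)

lemma id_on_surj_hom: "id_on {1..n} \<in> surj_hom n n"
  by (auto simp: surj_hom_def)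

lemma compose_surj_hom:
  assumes "s \<in> surj_hom n m" "t \<in> surj_hom m k"
  shows "compose {1..n} t s \<in> surj_hom n k"
proof -
  have "compose {1..n} t s ` {1..n} = {1..k}"
    using assms by (intro surj_compose) (auto simp: surj_hom_def)
  then show ?thesis unfolding surj_hom_def PiE_iff using compose_extensional by blast
qed

lemma surj_hom_self_inverse:
  assumes "\<sigma> \<in> surj_hom n n"
  obtains \<rho> where "\<rho> \<in> surj_hom n n" "compose {1..n} \<rho> \<sigma> = id_on {1..n}"
    "compose {1..n} \<sigma> \<rho> = id_on {1..n}"
proof
  define \<rho> where "\<rho> = restrict (inv_into {1..n} \<sigma>) {1..n}"
  have b: "bij_betw \<sigma> {1..n} {1..n}" using assms surj_hom_self_iff by blast
  show "\<rho> \<in> surj_hom n n"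
    unfolding surj_hom_self_iff \<rho>_def using bij_betw_inv_into[OF b]
    by (auto simp: bij_betw_imp_funcset)
  show "compose {1..n} \<rho> \<sigma> = id_on {1..n}" "compose {1..n} \<sigma> \<rho> = id_on {1..n}"
    unfolding \<rho>_def using b compose_inv_into_id compose_id_inv_into
    by (metis, metis bij_betw_def)
qed

lemma surj_inj_factorisation:
  assumes "g \<in> {1..n::nat} \<rightarrow>\<^sub>E Y"
  obtains k s y where "s \<in> surj_hom n k" "y \<in> {1..k} \<rightarrow>\<^sub>E Y" "inj_on y {1..k}"
    "g = compose {1..n} y s"
proof -
  define k where "k = card (g ` {1..n})"
  obtain y where y: "bij_betw y {1..k} (g ` {1..n})"
    using ex_bij_betw_nat_finite_1[of "g ` {1..n}"] unfolding k_def by auto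
  define s where "s = (\<lambda>i\<in>{1..n}. inv_into {1..k} y (g i))"
  have "s ` {1..n} = inv_into {1..k} y ` g ` {1..n}" by (simp add: s_def image_image)
  then have im: "s ` {1..n} = {1..k}"
    using bij_betw_imp_surj_on[OF bij_betw_inv_into[OF y]] by simp
  moreover have "s \<in> extensional {1..n}" by (simp add: s_def)
  ultimately have s: "s \<in> surj_hom n k" by (auto simp: surj_hom_def PiE_def)
  have ys: "y (s i) = g i" if "i \<in> {1..n}" for i
    using bij_betw_inv_into_right[OF y, of "g i"] that by (simp add: s_def)
  have "restrict y {1..k} \<in> {1..k} \<rightarrow>\<^sub>E Y"
    using bij_betw_imp_surj_on[OF y] PiE_mem[OF assms]
    by (intro restrict_PiE_iff[THEN iffD2]) (metis image_iff image_eqI)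
  moreover have "inj_on (restrict y {1..k}) {1..k}" using y by (simp add: bij_betw_def)
  moreover have "g = compose {1..n} (restrict y {1..k}) s"
  proof (rule extensionalityI[of _ "{1..n}"])
    fix i assume i: "i \<in> {1..n}"
    then have "s i \<in> {1..k}" using im by blast
    then show "g i = compose {1..n} (restrict y {1..k}) s i" using i ys by (simp add: compose_eq)
  qed (use assms in \<open>simp_all add: PiE_def compose_extensional\<close>)
  ultimately show ?thesis using that s by blast
qed

locale coefficients =
  fixes \<U> :: "'u set set" and C :: "'u coeff"
  assumes coeff_functor: "coeff_functor \<U> C"
begin

lemma car_closed: "s \<in> surj_hom n m \<Longrightarrow> r \<in> cob C n \<Longrightarrow> car C n m s r \<in> cob C m"
  using coeff_functor unfolding coeff_functor_def by blast

lemma car_id: "r \<in> cob C n \<Longrightarrow> car C n n (id_on {1..n}) r = r"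
  using coeff_functor unfolding coeff_functor_def by simp

lemma car_compose:
  assumes "s \<in> surj_hom n m" "t \<in> surj_hom m k" "r \<in> cob C n"
  shows "car C n k (compose {1..n} t s) r = car C m k t (car C n m s r)"
proof -
  have "car C n k (compose {1..n} t s) = compose (cob C n) (car C m k t) (car C n m s)"
    using coeff_functor assms unfolding coeff_functor_def by blast
  then show ?thesis using assms(3) by (simp add: compose_def)
qed

lemma sa_preI:
  "x \<in> {1..n} \<rightarrow>\<^sub>E X \<Longrightarrow> inj_on x {1..n} \<Longrightarrow> r \<in> cob C n \<Longrightarrow> (n, x, r) \<in> sa_pre C X"
  by (simp add: sa_pre_def)

lemma sa_preD:
  assumes "(n, x, r) \<in> sa_pre C X"
  shows "x \<in> {1..n} \<rightarrow>\<^sub>E X" "inj_on x {1..n}" "r \<in> cob C n"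
  using assms by (auto simp: sa_pre_def)

lemma sa_pre_compose:
  assumes "(n, x, r) \<in> sa_pre C X" "\<sigma> \<in> surj_hom n n" "q \<in> cob C n"
  shows "(n, compose {1..n} x \<sigma>, q) \<in> sa_pre C X"
proof (rule sa_preI)
  have s: "\<sigma> ` {1..n} = {1..n}" "inj_on \<sigma> {1..n}"
    using assms(2) surj_hom_self_inj by (auto simp: surj_hom_def)
  show "compose {1..n} x \<sigma> \<in> {1..n} \<rightarrow>\<^sub>E X"
    using s sa_preD(1)[OF assms(1)] by (auto simp: compose_def)
  have "inj_on (x \<circ> \<sigma>) {1..n}"
    using s sa_preD(2)[OF assms(1)] by (simp add: comp_inj_on)
  then show "inj_on (compose {1..n} x \<sigma>) {1..n}"
    by (subst inj_on_cong[of _ _ "x \<circ> \<sigma>"]) (simp_all add: compose_eq)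
qed (rule assms(3))

lemma sa_rel_iff:
  "((n, x, r), (m, y, q)) \<in> sa_rel C X \<longleftrightarrow>
     m = n \<and> (n, y, r) \<in> sa_pre C X \<and>
     (\<exists>\<sigma>\<in>surj_hom n n. x = compose {1..n} y \<sigma> \<and> q = car C n n \<sigma> r)"
proof
  assume "((n, x, r), (m, y, q)) \<in> sa_rel C X"
  then obtain \<sigma> where "m = n" "(n, y, r) \<in> sa_pre C X" "\<sigma> \<in> surj_hom n n"
    "x = compose {1..n} y \<sigma>" "q = car C n n \<sigma> r"
    unfolding sa_rel_def surj_hom_self_iff mem_Collect_eq by (elim exE conjE) simp
  then show "m = n \<and> (n, y, r) \<in> sa_pre C X \<and>
     (\<exists>\<sigma>\<in>surj_hom n n. x = compose {1..n} y \<sigma> \<and> q = car C n n \<sigma> r)" by blast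
next
  assume "m = n \<and> (n, y, r) \<in> sa_pre C X \<and>
     (\<exists>\<sigma>\<in>surj_hom n n. x = compose {1..n} y \<sigma> \<and> q = car C n n \<sigma> r)"
  then obtain \<sigma> where "m = n" "(n, y, r) \<in> sa_pre C X" "\<sigma> \<in> surj_hom n n"
    "x = compose {1..n} y \<sigma>" "q = car C n n \<sigma> r" by (elim conjE bexE)
  then show "((n, x, r), (m, y, q)) \<in> sa_rel C X"
    unfolding sa_rel_def surj_hom_self_iff mem_Collect_eq
    by (intro exI[of _ n] exI[of _ y] exI[of _ r] exI[of _ \<sigma>]) simp
qed

lemma equiv_sa_rel: "equiv (sa_pre C X) (sa_rel C X)"
proof (rule equivI)
  show "sa_rel C X \<subseteq> sa_pre C X \<times> sa_pre C X"
  proof clarify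
    fix n x r m y q assume "((n, x, r), (m, y, q)) \<in> sa_rel C X"
    then obtain \<sigma> where \<sigma>: "\<sigma> \<in> surj_hom n n" "x = compose {1..n} y \<sigma>" "q = car C n n \<sigma> r"
      and m: "m = n" and y: "(n, y, r) \<in> sa_pre C X"
      unfolding sa_rel_iff by blast
    have r: "r \<in> cob C n" by (rule sa_preD(3)[OF y])
    have "(n, y, q) \<in> sa_pre C X"
      unfolding \<sigma>(3) by (rule sa_preI[OF sa_preD(1,2)[OF y] car_closed[OF \<sigma>(1) r]])
    then show "(n, x, r) \<in> sa_pre C X \<and> (m, y, q) \<in> sa_pre C X"
      unfolding m \<sigma>(2) using sa_pre_compose[OF y \<sigma>(1) r] by blast
  qed
  show "refl_on (sa_pre C X) (sa_rel C X)"
  proof (rule refl_onI)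
    fix c assume c: "c \<in> sa_pre C X"
    obtain n x r where eq: "c = (n, x, r)" by (rule prod_cases3)
    have x: "(n, x, r) \<in> sa_pre C X" using c eq by simp
    have "compose {1..n} x (id_on {1..n}) = x" using sa_preD(1)[OF x] by (simp add: compose_id_on PiE_iff)
    then show "(c, c) \<in> sa_rel C X"
      unfolding eq sa_rel_iff using x id_on_surj_hom[of n] car_id[OF sa_preD(3)[OF x]] by metis
  qed
  show "sym (sa_rel C X)"
  proof (rule symI)
    fix c d assume cd: "(c, d) \<in> sa_rel C X"
    obtain n x r m y q where eq: "c = (n, x, r)" "d = (m, y, q)" by (cases c, cases d) auto
    obtain \<sigma> where s: "\<sigma> \<in> surj_hom n n" "x = compose {1..n} y \<sigma>" "q = car C n n \<sigma> r"
      and m: "m = n" and y: "(n, y, r) \<in> sa_pre C X"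
      using cd unfolding eq sa_rel_iff by blast
    obtain \<rho> where p: "\<rho> \<in> surj_hom n n" "compose {1..n} \<rho> \<sigma> = id_on {1..n}"
        "compose {1..n} \<sigma> \<rho> = id_on {1..n}"
      using surj_hom_self_inverse[OF s(1)] .
    have r: "r \<in> cob C n" using sa_preD[OF y] by simp
    have "compose {1..n} x \<rho> = compose {1..n} y (compose {1..n} \<sigma> \<rho>)"
      unfolding s(2) using p(1) by (intro compose_assoc[symmetric]) (auto simp: surj_hom_def)
    also have "\<dots> = y" using p(3) sa_preD(1)[OF y] by (simp add: compose_id_on PiE_iff)
    finally have "y = compose {1..n} x \<rho>" by simp
    moreover have "r = car C n n \<rho> q"
      using car_compose[OF s(1) p(1) r] p(2) car_id[OF r] s(3) by simp
    moreover have "(n, x, q) \<in> sa_pre C X"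
      unfolding s(2) using sa_pre_compose[OF y s(1)] car_closed[OF s(1) r] s(3) by simp
    ultimately show "(d, c) \<in> sa_rel C X" unfolding eq m sa_rel_iff using p(1) by blast
  qed
  show "trans (sa_rel C X)"
  proof (rule transI)
    fix c d e assume cd: "(c, d) \<in> sa_rel C X" and de: "(d, e) \<in> sa_rel C X"
    obtain n x r m y q l z p where
      eq: "c = (n, x, r)" "d = (m, y, q)" "e = (l, z, p)"
      by (cases c, cases d, cases e) auto
    obtain \<sigma> where s: "\<sigma> \<in> surj_hom n n" "x = compose {1..n} y \<sigma>" "q = car C n n \<sigma> r"
      and m: "m = n" and y: "(n, y, r) \<in> sa_pre C X"
      using cd unfolding eq sa_rel_iff by blast
    obtain \<rho> where t: "\<rho> \<in> surj_hom n n" "y = compose {1..n} z \<rho>" "p = car C n n \<rho> q"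
      and l: "l = n" and z: "(n, z, q) \<in> sa_pre C X"
      using de unfolding eq m sa_rel_iff by blast
    have r: "r \<in> cob C n" using sa_preD[OF y] by simp
    have "x = compose {1..n} z (compose {1..n} \<rho> \<sigma>)"
      unfolding s(2) t(2) using s(1) by (intro compose_assoc[symmetric]) (auto simp: surj_hom_def)
    moreover have "p = car C n n (compose {1..n} \<rho> \<sigma>) r"
      using car_compose[OF s(1) t(1) r] s(3) t(3) by simp
    moreover have "(n, z, r) \<in> sa_pre C X" using z r by (simp add: sa_pre_def)
    ultimately show "(c, e) \<in> sa_rel C X"
      unfolding eq m l sa_rel_iff using compose_surj_hom[OF s(1) t(1)] by blast
  qed
qed

lemma sa_cls_in_sa_ob: "(n, x, r) \<in> sa_pre C X \<Longrightarrow> sa_cls C X n x r \<in> sa_ob C X"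
  unfolding sa_cls_def sa_ob_def by (rule quotientI)

lemma sa_obE:
  assumes "c \<in> sa_ob C X"
  obtains n x r where "(n, x, r) \<in> sa_pre C X" "c = sa_cls C X n x r"
  using assms unfolding sa_ob_def sa_cls_def by (metis quotientE prod_cases3)

lemma sa_cls_self: "(n, x, r) \<in> sa_pre C X \<Longrightarrow> (n, x, r) \<in> sa_cls C X n x r"
  unfolding sa_cls_def using equiv_class_self[OF equiv_sa_rel] .

lemma sa_cls_eq_iff:
  assumes "(n, x, r) \<in> sa_pre C X" "(m, y, q) \<in> sa_pre C X"
  shows "sa_cls C X n x r = sa_cls C X m y q \<longleftrightarrow>
    m = n \<and> (\<exists>\<sigma>\<in>surj_hom n n. x = compose {1..n} y \<sigma> \<and> q = car C n n \<sigma> r)"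
proof -
  have "sa_cls C X n x r = sa_cls C X m y q \<longleftrightarrow> ((n, x, r), (m, y, q)) \<in> sa_rel C X"
    unfolding sa_cls_def using eq_equiv_class_iff[OF equiv_sa_rel] assms by blast
  also have "\<dots> \<longleftrightarrow> m = n \<and> (\<exists>\<sigma>\<in>surj_hom n n. x = compose {1..n} y \<sigma> \<and> q = car C n n \<sigma> r)"
    unfolding sa_rel_iff using assms by (auto simp: sa_pre_def)
  finally show ?thesis .
qed

lemma sa_cls_eq_image:
  assumes "(n, x, r) \<in> sa_pre C X" "(m, y, q) \<in> sa_pre C X"
    and "sa_cls C X n x r = sa_cls C X m y q"
  shows "x ` {1..n} = y ` {1..m}"
proof -
  obtain \<sigma> where "m = n" "\<sigma> ` {1..n} = {1..n}" "x = compose {1..n} y \<sigma>"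
    using assms sa_cls_eq_iff unfolding surj_hom_def by blast
  then show ?thesis by (metis surj_compose)
qed

text \<open>
  The values of \<open>sa_ar\<close> do not depend on choices. As \<open>y\<close> and \<open>y'\<close> have the same image,
  \<open>y = y' \<rho>\<close> for a permutation \<open>\<rho>\<close>. Cancelling the injection \<open>y'\<close> in
  \<open>y' \<rho> s = y' s' \<sigma>\<close> gives \<open>\<rho> s = s' \<sigma>\<close>, so that \<open>\<rho>\<close> also takes one coefficient to
  the other.
\<close>

lemma sa_cls_factorisation_unique:
  assumes x: "(n, x, r) \<in> sa_pre C X" and x': "(n, x', r') \<in> sa_pre C X"
    and \<sigma>: "\<sigma> \<in> surj_hom n n" "x = compose {1..n} x' \<sigma>" "r' = car C n n \<sigma> r"
    and s: "s \<in> surj_hom n k" and y: "y \<in> {1..k} \<rightarrow>\<^sub>E Y" "inj_on y {1..k}"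
    and fx: "compose {1..n} f x = compose {1..n} y s"
    and s': "s' \<in> surj_hom n k'" and y': "y' \<in> {1..k'} \<rightarrow>\<^sub>E Y" "inj_on y' {1..k'}"
    and fx': "compose {1..n} f x' = compose {1..n} y' s'"
  shows "sa_cls C Y k y (car C n k s r) = sa_cls C Y k' y' (car C n k' s' r')"
proof -
  have r: "r \<in> cob C n" "r' \<in> cob C n" using sa_preD x x' by auto
  have im: "s ` {1..n} = {1..k}" "s' ` {1..n} = {1..k'}" "\<sigma> ` {1..n} = {1..n}"
    using s s' \<sigma>(1) by (auto simp: surj_hom_def)
  have pw: "y (s i) = y' (s' (\<sigma> i))" if i: "i \<in> {1..n}" for i
  proof -
    have "y (s i) = f (x i)" using fun_cong[OF fx, of i] i by (simp add: compose_def)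
    also have "\<dots> = f (x' (\<sigma> i))" using \<sigma>(2) i by (simp add: compose_def)
    also have "\<dots> = y' (s' (\<sigma> i))"
      using fun_cong[OF fx', of "\<sigma> i"] i im(3) by (auto simp: compose_def split: if_splits)
    finally show ?thesis .
  qed
  have "y ` {1..k} = (\<lambda>i. y (s i)) ` {1..n}" unfolding im(1)[symmetric] by (simp add: image_image)
  also have "\<dots> = (\<lambda>i. y' (s' (\<sigma> i))) ` {1..n}" using pw by (rule image_cong[OF refl])
  also have "\<dots> = y' ` s' ` \<sigma> ` {1..n}" by (simp add: image_image)
  also have "\<dots> = y' ` {1..k'}" unfolding im ..
  finally have ims: "y ` {1..k} = y' ` {1..k'}" .
  then have k: "k' = k" using card_image[OF y(2)] card_image[OF y'(2)] by simp
  define \<rho> where "\<rho> = (\<lambda>j\<in>{1..k}. inv_into {1..k} y' (y j))"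
  have \<rho>y: "\<rho> j \<in> {1..k}" "y' (\<rho> j) = y j" if "j \<in> {1..k}" for j
  proof -
    have yj: "y j \<in> y' ` {1..k}" using that ims k by blast
    have \<rho>j: "\<rho> j = inv_into {1..k} y' (y j)" unfolding \<rho>_def using that by (rule restrict_apply')
    show "\<rho> j \<in> {1..k}" unfolding \<rho>j using yj by (rule inv_into_into)
    show "y' (\<rho> j) = y j" unfolding \<rho>j using yj by (rule f_inv_into_f)
  qed
  have inj: "inj_on \<rho> {1..k}"
  proof (rule inj_onI)
    fix i j assume ij: "i \<in> {1..k}" "j \<in> {1..k}" and "\<rho> i = \<rho> j"
    then have "y i = y j" using \<rho>y(2)[OF ij(1)] \<rho>y(2)[OF ij(2)] by simp
    then show "i = j" using inj_onD[OF y(2)] ij by blast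
  qed
  have "\<rho> ` {1..k} = {1..k}" using \<rho>y(1) inj by (intro endo_inj_surj) auto
  moreover have "\<rho> \<in> extensional {1..k}" by (simp add: \<rho>_def)
  ultimately have \<rho>: "\<rho> \<in> surj_hom k k" by (auto simp: surj_hom_def PiE_def)
  have y_eq: "y = compose {1..k} y' \<rho>"
    using y(1) \<rho>y(2) by (intro extensionalityI[of _ "{1..k}"]) (auto simp: compose_def PiE_def)
  have "compose {1..n} \<rho> s = compose {1..n} s' \<sigma>"
  proof (rule extensionalityI[of _ "{1..n}"])
    fix i assume i: "i \<in> {1..n}"
    have si: "s i \<in> {1..k}" "s' (\<sigma> i) \<in> {1..k}" using i im k by blast+
    have "y' (\<rho> (s i)) = y' (s' (\<sigma> i))" using pw[OF i] \<rho>y(2)[OF si(1)] by simp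
    then show "compose {1..n} \<rho> s i = compose {1..n} s' \<sigma> i"
      using inj_onD[OF y'(2)] \<rho>y(1)[OF si(1)] si(2) i k by (simp add: compose_def)
  qed (simp_all add: compose_extensional)
  then have "car C n k s' r' = car C k k \<rho> (car C n k s r)"
    using car_compose[OF \<sigma>(1) s' r(1)] car_compose[OF s \<rho> r(1)] \<sigma>(3) k by simp
  moreover have "(k, y, car C n k s r) \<in> sa_pre C Y" "(k, y', car C n k s' r') \<in> sa_pre C Y"
    using y y' s s' r car_closed k by (auto intro!: sa_preI)
  ultimately show ?thesis using sa_cls_eq_iff \<rho> y_eq k by blast
qed

lemma sa_ar_sa_cls:
  assumes x: "(n, x, r) \<in> sa_pre C X"
    and s: "s \<in> surj_hom n k" and y: "y \<in> {1..k} \<rightarrow>\<^sub>E Y" "inj_on y {1..k}"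
    and fx: "compose {1..n} f x = compose {1..n} y s"
  shows "sa_ar C X Y f (sa_cls C X n x r) = sa_cls C Y k y (car C n k s r)"
proof -
  have "(THE d. \<exists>n' x' r' k' s' y'.
     (n', x', r') \<in> sa_cls C X n x r \<and> s' \<in> surj_hom n' k' \<and>
     y' \<in> {1..k'} \<rightarrow>\<^sub>E Y \<and> inj_on y' {1..k'} \<and>
     compose {1..n'} f x' = compose {1..n'} y' s' \<and> d = sa_cls C Y k' y' (car C n' k' s' r')) =
     sa_cls C Y k y (car C n k s r)"
  proof (rule the_equality)
    show "\<exists>n' x' r' k' s' y'.
     (n', x', r') \<in> sa_cls C X n x r \<and> s' \<in> surj_hom n' k' \<and>
     y' \<in> {1..k'} \<rightarrow>\<^sub>E Y \<and> inj_on y' {1..k'} \<and>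
     compose {1..n'} f x' = compose {1..n'} y' s' \<and>
     sa_cls C Y k y (car C n k s r) = sa_cls C Y k' y' (car C n' k' s' r')"
      by (rule exI[of _ n], rule exI[of _ x], rule exI[of _ r], rule exI[of _ k],
          rule exI[of _ s], rule exI[of _ y]) (intro conjI sa_cls_self x s y fx refl)
    fix d assume "\<exists>n' x' r' k' s' y'.
     (n', x', r') \<in> sa_cls C X n x r \<and> s' \<in> surj_hom n' k' \<and>
     y' \<in> {1..k'} \<rightarrow>\<^sub>E Y \<and> inj_on y' {1..k'} \<and>
     compose {1..n'} f x' = compose {1..n'} y' s' \<and> d = sa_cls C Y k' y' (car C n' k' s' r')"
    then obtain n' x' r' k' s' y' where
      cls: "(n', x', r') \<in> sa_cls C X n x r" and
      s': "s' \<in> surj_hom n' k'" and y': "y' \<in> {1..k'} \<rightarrow>\<^sub>E Y" "inj_on y' {1..k'}"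
      and fx': "compose {1..n'} f x' = compose {1..n'} y' s'"
      and d: "d = sa_cls C Y k' y' (car C n' k' s' r')" by blast
    have rel: "((n, x, r), (n', x', r')) \<in> sa_rel C X" using cls by (simp add: sa_cls_def)
    then have x': "(n', x', r') \<in> sa_pre C X"
      using equiv_sa_rel by (auto simp: equiv_def)
    obtain \<sigma> where n: "n' = n" and
      \<sigma>: "\<sigma> \<in> surj_hom n n" "x = compose {1..n} x' \<sigma>" "r' = car C n n \<sigma> r"
      using rel unfolding sa_rel_iff by blast
    show "d = sa_cls C Y k y (car C n k s r)"
      unfolding d n
      by (rule sa_cls_factorisation_unique[OF x x'[unfolded n] \<sigma> s y fx
            s'[unfolded n] y' fx'[unfolded n], symmetric])
  qed
  then show ?thesis
    unfolding sa_ar_def using sa_cls_in_sa_ob[OF x] by simp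
qed

lemma sa_ar_sa_cls_inj:
  assumes x: "(n, x, r) \<in> sa_pre C X" and f: "f \<in> X \<rightarrow>\<^sub>E Y" "inj_on f X"
  shows "(n, compose {1..n} f x, r) \<in> sa_pre C Y"
    and "sa_ar C X Y f (sa_cls C X n x r) = sa_cls C Y n (compose {1..n} f x) r"
proof -
  have fx: "compose {1..n} f x \<in> {1..n} \<rightarrow>\<^sub>E Y"
    using f(1) sa_preD(1)[OF x] by (auto simp: compose_def)
  have "inj_on (f \<circ> x) {1..n}"
    using sa_preD[OF x] f(2) by (intro comp_inj_on) (auto simp: PiE_iff intro: inj_on_subset)
  then have inj: "inj_on (compose {1..n} f x) {1..n}"
    by (subst inj_on_cong[of _ _ "f \<circ> x"]) (simp_all add: compose_eq)
  show "(n, compose {1..n} f x, r) \<in> sa_pre C Y" 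
    using fx inj sa_preD(3)[OF x] by (rule sa_preI)
  have "compose {1..n} f x = compose {1..n} (compose {1..n} f x) (id_on {1..n})"
    by (simp add: compose_id_on compose_extensional)
  then have "sa_ar C X Y f (sa_cls C X n x r) =
      sa_cls C Y n (compose {1..n} f x) (car C n n (id_on {1..n}) r)"
    by (rule sa_ar_sa_cls[OF x id_on_surj_hom fx inj])
  then show "sa_ar C X Y f (sa_cls C X n x r) = sa_cls C Y n (compose {1..n} f x) r"
    using car_id sa_preD(3)[OF x] by simp
qed

text \<open>
  Both sides are computed by the same factorisation of \<open>f \<circ> x\<close>. The lemma trades the domain
  \<open>{1..n}\<close>, which is not an object of the universe, for one that is.
\<close>

lemma sa_ar_sa_cls_id:
  assumes x: "(n, x, r) \<in> sa_pre C X" and f: "f \<in> X \<rightarrow>\<^sub>E Y"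
  shows "sa_ar C {1..n} Y (compose {1..n} f x) (sa_cls C {1..n} n (id_on {1..n}) r) =
    sa_ar C X Y f (sa_cls C X n x r)"
proof -
  have "compose {1..n} f x \<in> {1..n} \<rightarrow>\<^sub>E Y"
    using f sa_preD(1)[OF x] by (auto simp: compose_def)
  then obtain k s y where fac: "s \<in> surj_hom n k" "y \<in> {1..k} \<rightarrow>\<^sub>E Y" "inj_on y {1..k}"
    "compose {1..n} f x = compose {1..n} y s" by (rule surj_inj_factorisation)
  have id: "(n, id_on {1..n}, r) \<in> sa_pre C {1..n}"
    using sa_preD(3)[OF x] by (intro sa_preI) auto
  have "compose {1..n} (compose {1..n} f x) (id_on {1..n}) = compose {1..n} y s"
    
    using fac(4) compose_id_on[OF compose_extensional] by metis
  then show ?thesis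
    using sa_ar_sa_cls[OF x fac] sa_ar_sa_cls[OF id fac(1-3)] by simp
qed

end

section \<open>Small sets\<close>

context set_universe
begin

lemma finite_in_universe:
  assumes "finite X"
  shows "X \<in> \<U>"
proof -
  obtain I where I: "I \<in> \<U>" "infinite I" using infinity by blast
  obtain J where J: "J \<subseteq> I" "finite J" "card J = card X"
    using infinite_arbitrarily_large[OF I(2)] by metis
  obtain h where "bij_betw h J X" using finite_same_card_bij[OF J(2) assms J(3)] by blast
  then have "h ` J = X" by (rule bij_betw_imp_surj_on)
  then show ?thesis using image_closed[OF subset_closed[OF I(1) J(1)], of h] by simp
qed

lemma inv_pr [simp]: "inv pr (pr w) = w"
  using inj_pr by (rule inv_f_f)

lemma pr_in_coprod: "a \<in> I \<Longrightarrow> z \<in> F a \<Longrightarrow> pr (a, z) \<in> coprod pr I F"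
  unfolding coprod_def by blast

lemma coprodE:
  assumes "w \<in> coprod pr I F"
  obtains a z where "a \<in> I" "z \<in> F a" "w = pr (a, z)"
  using assms unfolding coprod_def by blast

lemma coprod_in_universe:
  assumes "I \<in> \<U>" "\<And>a. a \<in> I \<Longrightarrow> F a \<in> \<U>"
  shows "coprod pr I F \<in> \<U>"
proof -
  have "coprod pr I F = (\<Union>a\<in>I. (\<lambda>z. pr (a, z)) ` F a)"
    unfolding coprod_def by auto
  also have "\<dots> \<in> \<U>" using assms by (intro Union_closed image_closed)
  finally show ?thesis .
qed

lemma coprod_map_pr:
  assumes "a \<in> I" "z \<in> F a"
  shows "coprod_map pr I F g (pr (a, z)) = pr (a, g a z)"
  using pr_in_coprod[of a I z F] assms by (simp add: coprod_map_def)

end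


section \<open>Supports\<close>

lemma endofunctor_ar:
  assumes "endofunctor \<U> F" "X \<in> \<U>" "Y \<in> \<U>" "f \<in> X \<rightarrow>\<^sub>E Y"
  shows "ar F X Y f \<in> ob F X \<rightarrow>\<^sub>E ob F Y"
  using assms unfolding endofunctor_def by blast

lemma nat_trans_closed:
  assumes "nat_trans \<U> F G \<alpha>" "X \<in> \<U>"
  shows "\<alpha> X \<in> ob F X \<rightarrow>\<^sub>E ob G X"
  using assms unfolding nat_trans_def by blast

lemma nat_trans_natural:
  assumes "nat_trans \<U> F G \<alpha>" "X \<in> \<U>" "Y \<in> \<U>" "f \<in> X \<rightarrow>\<^sub>E Y" and t: "t \<in> ob F X"
  shows "ar G X Y f (\<alpha> X t) = \<alpha> Y (ar F X Y f t)"
proof -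
  have "compose (ob F X) (ar G X Y f) (\<alpha> X) = compose (ob F X) (\<alpha> Y) (ar F X Y f)"
    using assms unfolding nat_trans_def by blast
  from fun_cong[OF this, of t] show ?thesis using t by (simp add: compose_eq)
qed

locale sa_functor = set_universe \<U> pr + coefficients \<U> C
  for \<U> :: "'u set set" and pr :: "'u \<times> 'u \<Rightarrow> 'u" and C +
  fixes T :: "('u, 'm) monad_scheme"
    and \<phi> :: "'u set \<Rightarrow> ('u, 'u) sa_rep set \<Rightarrow> 'u"
  assumes endofunctor: "endofunctor \<U> T"
    and presentation: "sa_presentation \<U> T C \<phi>"
begin

lemma ar_closed:
  assumes "X \<in> \<U>" "Y \<in> \<U>" "f \<in> X \<rightarrow>\<^sub>E Y" "t \<in> ob T X"
  shows "ar T X Y f t \<in> ob T Y"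
  using endofunctor_ar[OF endofunctor assms(1-3)] assms(4) by (rule PiE_mem)

lemma phi_bij: "X \<in> \<U> \<Longrightarrow> bij_betw (\<phi> X) (sa_ob C X) (ob T X)"
  using presentation unfolding sa_presentation_def by blast

lemma phi_closed:
  assumes "X \<in> \<U>" "(n, x, r) \<in> sa_pre C X"
  shows "\<phi> X (sa_cls C X n x r) \<in> ob T X"
  using bij_betw_apply[OF phi_bij[OF assms(1)] sa_cls_in_sa_ob[OF assms(2)]] .

lemma ar_phi:
  assumes "X \<in> \<U>" "Y \<in> \<U>" "f \<in> X \<rightarrow>\<^sub>E Y" "(n, x, r) \<in> sa_pre C X"
  shows "ar T X Y f (\<phi> X (sa_cls C X n x r)) = \<phi> Y (sa_ar C X Y f (sa_cls C X n x r))"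
  using presentation assms(1-3) sa_cls_in_sa_ob[OF assms(4)] unfolding sa_presentation_def by blast

lemma obE:
  assumes "X \<in> \<U>" "t \<in> ob T X"
  obtains n x r where "(n, x, r) \<in> sa_pre C X" "t = \<phi> X (sa_cls C X n x r)"
proof -
  have "t \<in> \<phi> X ` sa_ob C X" using phi_bij[OF assms(1)] assms(2) by (simp add: bij_betw_def)
  then obtain c where c: "c \<in> sa_ob C X" "t = \<phi> X c" by blast
  obtain n x r where "(n, x, r) \<in> sa_pre C X" "c = sa_cls C X n x r" using sa_obE[OF c(1)] .
  then show ?thesis using that c(2) by blast
qed

lemma phi_eq_iff:
  assumes X: "X \<in> \<U>" and x: "(n, x, r) \<in> sa_pre C X" and y: "(m, y, q) \<in> sa_pre C X"
  shows "\<phi> X (sa_cls C X n x r) = \<phi> X (sa_cls C X m y q) \<longleftrightarrow>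
    m = n \<and> (\<exists>\<sigma>\<in>surj_hom n n. x = compose {1..n} y \<sigma> \<and> q = car C n n \<sigma> r)"
proof -
  have "inj_on (\<phi> X) (sa_ob C X)" using phi_bij[OF X] by (simp add: bij_betw_def)
  then have "\<phi> X (sa_cls C X n x r) = \<phi> X (sa_cls C X m y q) \<longleftrightarrow>
      sa_cls C X n x r = sa_cls C X m y q"
    using sa_cls_in_sa_ob[OF x] sa_cls_in_sa_ob[OF y] by (rule inj_on_eq_iff)
  then show ?thesis unfolding sa_cls_eq_iff[OF x y] .
qed

text \<open>
  The elements of \<open>X\<close> that occur in \<open>t\<close>: equivalent representatives differ by a permutation
  of their variables, which does not change the image.
\<close>

definition supp :: "'u set \<Rightarrow> 'u \<Rightarrow> 'u set" where
  "supp X t = (THE Z. \<exists>n x r. (n, x, r) \<in> sa_pre C X \<and>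
     t = \<phi> X (sa_cls C X n x r) \<and> Z = x ` {1..n})"

lemma supp_phi:
  assumes X: "X \<in> \<U>" and x: "(n, x, r) \<in> sa_pre C X"
  shows "supp X (\<phi> X (sa_cls C X n x r)) = x ` {1..n}"
  unfolding supp_def
proof (rule the_equality)
  show "\<exists>n' x' r'. (n', x', r') \<in> sa_pre C X \<and>
     \<phi> X (sa_cls C X n x r) = \<phi> X (sa_cls C X n' x' r') \<and> x ` {1..n} = x' ` {1..n'}"
    using x by blast
  fix Z assume "\<exists>n' x' r'. (n', x', r') \<in> sa_pre C X \<and>
     \<phi> X (sa_cls C X n x r) = \<phi> X (sa_cls C X n' x' r') \<and> Z = x' ` {1..n'}"
  then obtain m y q where y: "(m, y, q) \<in> sa_pre C X" and Z: "Z = y ` {1..m}"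
    and eq: "\<phi> X (sa_cls C X n x r) = \<phi> X (sa_cls C X m y q)" by blast
  have "sa_cls C X n x r = sa_cls C X m y q"
    using eq unfolding phi_eq_iff[OF X x y] sa_cls_eq_iff[OF x y] .
  then show "Z = x ` {1..n}" using sa_cls_eq_image[OF x y] Z by simp
qed

lemma supp_subset:
  assumes X: "X \<in> \<U>" and t: "t \<in> ob T X"
  shows "supp X t \<subseteq> X"
proof -
  obtain n x r where x: "(n, x, r) \<in> sa_pre C X" and teq: "t = \<phi> X (sa_cls C X n x r)"
    using obE[OF X t] .
  show ?thesis unfolding teq supp_phi[OF X x] using sa_preD(1)[OF x] by blast
qed

lemma finite_supp:
  assumes X: "X \<in> \<U>" and t: "t \<in> ob T X"
  shows "finite (supp X t)"
proof -
  obtain n x r where x: "(n, x, r) \<in> sa_pre C X" and teq: "t = \<phi> X (sa_cls C X n x r)"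
    using obE[OF X t] .
  show ?thesis unfolding teq supp_phi[OF X x] by simp
qed

lemma supp_ar:
  assumes X: "X \<in> \<U>" and Y: "Y \<in> \<U>" and f: "f \<in> X \<rightarrow>\<^sub>E Y" and t: "t \<in> ob T X"
  shows "supp Y (ar T X Y f t) = f ` supp X t"
proof -
  obtain n x r where x: "(n, x, r) \<in> sa_pre C X" and teq: "t = \<phi> X (sa_cls C X n x r)"
    using obE[OF X t] .
  have "compose {1..n} f x \<in> {1..n} \<rightarrow>\<^sub>E Y"
    using f sa_preD(1)[OF x] by (auto simp: compose_def)
  then obtain k s y where s: "s \<in> surj_hom n k" and y: "y \<in> {1..k} \<rightarrow>\<^sub>E Y" "inj_on y {1..k}"
    and fx: "compose {1..n} f x = compose {1..n} y s" by (rule surj_inj_factorisation)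
  have pre: "(k, y, car C n k s r) \<in> sa_pre C Y"
    using y car_closed[OF s sa_preD(3)[OF x]] by (rule sa_preI)
  have "supp Y (ar T X Y f t) = y ` {1..k}"
    unfolding teq ar_phi[OF X Y f x] sa_ar_sa_cls[OF x s y fx] by (rule supp_phi[OF Y pre])
  also have "\<dots> = compose {1..n} y s ` {1..n}"
    using s by (intro surj_compose[symmetric]) (auto simp: surj_hom_def)
  also have "\<dots> = f ` x ` {1..n}"
    unfolding fx[symmetric] by (auto simp: compose_def)
  finally show ?thesis unfolding teq supp_phi[OF X x] .
qed

lemma ar_inj:
  assumes X: "X \<in> \<U>" and Y: "Y \<in> \<U>" and f: "f \<in> X \<rightarrow>\<^sub>E Y" "inj_on f X"
  shows "inj_on (ar T X Y f) (ob T X)"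
proof (rule inj_onI)
  fix t u assume t: "t \<in> ob T X" and u: "u \<in> ob T X" and eq: "ar T X Y f t = ar T X Y f u"
  obtain n x r where x: "(n, x, r) \<in> sa_pre C X" and teq: "t = \<phi> X (sa_cls C X n x r)"
    using obE[OF X t] .
  obtain m y q where y: "(m, y, q) \<in> sa_pre C X" and ueq: "u = \<phi> X (sa_cls C X m y q)"
    using obE[OF X u] .
  obtain \<sigma> where m: "m = n" and \<sigma>: "\<sigma> \<in> surj_hom n n" and q: "q = car C n n \<sigma> r"
    and fx: "compose {1..n} f x = compose {1..n} (compose {1..m} f y) \<sigma>"
    using eq unfolding teq ueq ar_phi[OF X Y f(1) x] ar_phi[OF X Y f(1) y]
      sa_ar_sa_cls_inj(2)[OF x f] sa_ar_sa_cls_inj(2)[OF y f]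
      phi_eq_iff[OF Y sa_ar_sa_cls_inj(1)[OF x f] sa_ar_sa_cls_inj(1)[OF y f]] by blast
  have "x = compose {1..n} y \<sigma>"
  proof (rule extensionalityI[of _ "{1..n}"])
    fix i assume i: "i \<in> {1..n}"
    have \<sigma>i: "\<sigma> i \<in> {1..n}" using \<sigma> i by (auto simp: surj_hom_def)
    have "f (x i) = f (y (\<sigma> i))"
      using fun_cong[OF fx, of i] i \<sigma>i m by (simp add: compose_eq)
    moreover have "x i \<in> X" "y (\<sigma> i) \<in> X"
      using PiE_mem[OF sa_preD(1)[OF x] i] PiE_mem[OF sa_preD(1)[OF y]] \<sigma>i m by blast+
    ultimately have "x i = y (\<sigma> i)" by (rule inj_onD[OF f(2)])
    then show "x i = compose {1..n} y \<sigma> i" using i by (simp add: compose_eq)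
  qed (use sa_preD(1)[OF x] in \<open>simp_all add: PiE_def compose_extensional\<close>)
  then show "t = u" unfolding teq ueq phi_eq_iff[OF X x y] using m \<sigma> q by blast
qed

text \<open>
  This and \<open>ar_inj\<close> express that the functor preserves pullbacks along monos: \<open>T X\<close> is a
  subset of \<open>T Y\<close> that is cut out by a condition on supports.
\<close>

lemma in_image_ar_iff_supp:
  assumes X: "X \<in> \<U>" and Y: "Y \<in> \<U>" and f: "f \<in> X \<rightarrow>\<^sub>E Y" "inj_on f X" and u: "u \<in> ob T Y"
  shows "u \<in> ar T X Y f ` ob T X \<longleftrightarrow> supp Y u \<subseteq> f ` X"
proof
  assume "u \<in> ar T X Y f ` ob T X"
  then obtain t where t: "t \<in> ob T X" "u = ar T X Y f t" by blast
  show "supp Y u \<subseteq> f ` X"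
    unfolding t(2) supp_ar[OF X Y f(1) t(1)] using supp_subset[OF X t(1)] by (rule image_mono)
next
  assume sub: "supp Y u \<subseteq> f ` X"
  obtain n y r where y: "(n, y, r) \<in> sa_pre C Y" and ueq: "u = \<phi> Y (sa_cls C Y n y r)"
    using obE[OF Y u] .
  have yX: "y i \<in> f ` X" if "i \<in> {1..n}" for i
    using sub that unfolding ueq supp_phi[OF Y y] by blast
  define x where "x = (\<lambda>i\<in>{1..n}. inv_into X f (y i))"
  have fx: "f (x i) = y i" and xX: "x i \<in> X" if "i \<in> {1..n}" for i
    using f_inv_into_f[OF yX[OF that]] inv_into_into[OF yX[OF that]] that
    unfolding x_def by simp_all
  have comp: "compose {1..n} f x = y"
    using sa_preD(1)[OF y] fx
    by (intro extensionalityI[of _ "{1..n}"]) (simp_all add: PiE_def compose_extensional compose_eq)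
  have x: "(n, x, r) \<in> sa_pre C X"
  proof (rule sa_preI)
    show "x \<in> {1..n} \<rightarrow>\<^sub>E X" using xX by (auto simp: x_def)
    show "inj_on x {1..n}"
    proof (rule inj_onI)
      fix i j assume ij: "i \<in> {1..n}" "j \<in> {1..n}" "x i = x j"
      then have "y i = y j" using fx by metis
      then show "i = j" using inj_onD[OF sa_preD(2)[OF y]] ij by blast
    qed
    show "r \<in> cob C n" by (rule sa_preD(3)[OF y])
  qed
  have "ar T X Y f (\<phi> X (sa_cls C X n x r)) = u"
    unfolding ar_phi[OF X Y f(1) x] sa_ar_sa_cls_inj(2)[OF x f] comp ueq ..
  then show "u \<in> ar T X Y f ` ob T X" using phi_closed[OF X x] by blast
qed

lemma restrict_to_supp:
  assumes X: "X \<in> \<U>" and t: "t \<in> ob T X" and Z: "supp X t \<subseteq> Z" "Z \<subseteq> X"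
  obtains t0 where "t0 \<in> ob T Z" "ar T Z X (id_on Z) t0 = t"
proof -
  have "id_on Z \<in> Z \<rightarrow>\<^sub>E X" "inj_on (id_on Z) Z" "supp X t \<subseteq> id_on Z ` Z"
    using Z by auto
  then have "t \<in> ar T Z X (id_on Z) ` ob T Z"
    using in_image_ar_iff_supp[OF subset_closed[OF X Z(2)] X _ _ t] by blast
  then show ?thesis using that by blast
qed

end


section \<open>Semi-cartesian transformations preserve supports\<close>

locale sa_transformation =
  R: sa_functor \<U> pr CR R \<phi>R + V: sa_functor \<U> pr CV V \<phi>V
  for \<U> :: "'u set set" and pr CR and R :: "('u, 'm) monad_scheme" and \<phi>R
    and CV and V :: "('u, 'n) monad_scheme" and \<phi>V +
  fixes \<tau> :: "'u set \<Rightarrow> 'u \<Rightarrow> 'u"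
  assumes natural: "nat_trans \<U> R V \<tau>"
begin

lemmas tau_mem = PiE_mem[OF nat_trans_closed[OF natural]]
lemmas tau_natural = nat_trans_natural[OF natural]

text \<open>
  An element comes from its support \<open>Z\<close>, and by naturality \<open>\<tau>\<close> sends it to an element that
  comes from \<open>Z\<close> too.
\<close>

lemma supp_tau_subset:
  assumes X: "X \<in> \<U>" and t: "t \<in> ob R X"
  shows "V.supp X (\<tau> X t) \<subseteq> R.supp X t"
proof -
  let ?Z = "R.supp X t"
  have Z: "?Z \<subseteq> X" "?Z \<in> \<U>" using R.supp_subset[OF X t] R.subset_closed[OF X] by auto
  then have i: "id_on ?Z \<in> ?Z \<rightarrow>\<^sub>E X" by auto
  obtain t0 where t0: "t0 \<in> ob R ?Z" "ar R ?Z X (id_on ?Z) t0 = t"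
    using R.restrict_to_supp[OF X t order_refl Z(1)] .
  have "V.supp X (\<tau> X t) = V.supp X (ar V ?Z X (id_on ?Z) (\<tau> ?Z t0))"
    using tau_natural[OF Z(2) X i t0(1)] t0(2) by simp
  also have "\<dots> = id_on ?Z ` V.supp ?Z (\<tau> ?Z t0)"
    by (rule V.supp_ar[OF Z(2) X i tau_mem[OF Z(2) t0(1)]])
  also have "\<dots> \<subseteq> ?Z" using V.supp_subset[OF Z(2) tau_mem[OF Z(2) t0(1)]] by auto
  finally show ?thesis .
qed

text \<open>
  Let \<open>Z\<close> be the support of \<open>\<tau> t\<close>. The element \<open>t\<close> and the restriction of \<open>\<tau> t\<close> to \<open>Z\<close> form
  a cone over the square at the inclusion of \<open>Z\<close>, with a one-point vertex. Its mediating map shows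
  that \<open>t\<close> comes from \<open>Z\<close>.
\<close>

lemma semi_cartesian_supp_tau:
  assumes sc: "semi_cartesian \<U> R V \<tau>" and X: "X \<in> \<U>" and t: "t \<in> ob R X"
  shows "R.supp X t \<subseteq> V.supp X (\<tau> X t)"
proof -
  let ?Z = "V.supp X (\<tau> X t)"
  have Z: "?Z \<subseteq> X" "?Z \<in> \<U>"
    using V.supp_subset[OF X tau_mem[OF X t]] R.subset_closed[OF X] by auto
  then have i: "id_on ?Z \<in> ?Z \<rightarrow>\<^sub>E X" "inj_on (id_on ?Z) ?Z" by auto
  obtain v where v: "v \<in> ob V ?Z" "ar V ?Z X (id_on ?Z) v = \<tau> X t"
    using V.restrict_to_supp[OF X tau_mem[OF X t] order_refl Z(1)] .
  have "is_pullback \<U> (ob R ?Z) (ob R X) (ob V ?Z) (ob V X)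
      (ar R ?Z X (id_on ?Z)) (\<tau> ?Z) (\<tau> X) (ar V ?Z X (id_on ?Z))"
    using sc X Z(2) i unfolding semi_cartesian_def by blast
  then have pb: "\<exists>!m. m \<in> W \<rightarrow>\<^sub>E ob R ?Z \<and> compose W (ar R ?Z X (id_on ?Z)) m = h \<and>
      compose W (\<tau> ?Z) m = k"
    if "W \<in> \<U>" "h \<in> W \<rightarrow>\<^sub>E ob R X" "k \<in> W \<rightarrow>\<^sub>E ob V ?Z"
      "compose W (\<tau> X) h = compose W (ar V ?Z X (id_on ?Z)) k" for W h k
    using that unfolding is_pullback_def by blast
  \<comment> \<open>The vertex of the cone may be any one-point set; \<open>{t}\<close> is one at hand.\<close>
  let ?h = "\<lambda>w\<in>{t}. t" and ?k = "\<lambda>w\<in>{t}. v"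
  have "\<exists>!m. m \<in> {t} \<rightarrow>\<^sub>E ob R ?Z \<and> compose {t} (ar R ?Z X (id_on ?Z)) m = ?h \<and>
      compose {t} (\<tau> ?Z) m = ?k"
  proof (rule pb)
    show "{t} \<in> \<U>" by (rule R.finite_in_universe) simp
    show "compose {t} (\<tau> X) ?h = compose {t} (ar V ?Z X (id_on ?Z)) ?k"
      using v(2) by (intro extensionalityI[of _ "{t}"]) (simp_all add: compose_extensional compose_eq)
  qed (use t v(1) in simp_all)
  then obtain m where m: "m \<in> {t} \<rightarrow>\<^sub>E ob R ?Z" "compose {t} (ar R ?Z X (id_on ?Z)) m = ?h"
    by blast
  have mt: "m t \<in> ob R ?Z" "ar R ?Z X (id_on ?Z) (m t) = t"
    using PiE_mem[OF m(1), of t] fun_cong[OF m(2), of t] by (simp_all add: compose_eq)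
  have "R.supp X t = id_on ?Z ` R.supp ?Z (m t)"
    using R.supp_ar[OF Z(2) X i(1) mt(1)] mt(2) by simp
  also have "\<dots> \<subseteq> ?Z" using R.supp_subset[OF Z(2) mt(1)] by auto
  finally show ?thesis .
qed

text \<open>
  A cone \<open>(h, k)\<close> satisfies \<open>\<tau> (h w) = V f (k w)\<close>, so \<open>\<tau> (h w)\<close>, and then \<open>h w\<close>, has its
  support in the image of \<open>f\<close>. Hence \<open>h w\<close> has a preimage under \<open>R f\<close>, which is unique
  because \<open>R f\<close> is injective; it lies over \<open>k w\<close> because \<open>V f\<close> is injective.
\<close>

lemma supp_tau_semi_cartesian:
  assumes supp: "\<And>X t. X \<in> \<U> \<Longrightarrow> t \<in> ob R X \<Longrightarrow> V.supp X (\<tau> X t) = R.supp X t"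
  shows "semi_cartesian \<U> R V \<tau>"
  unfolding semi_cartesian_def
proof (intro conjI ballI impI natural)
  fix X Y f assume X: "X \<in> \<U>" and Y: "Y \<in> \<U>" and f: "f \<in> X \<rightarrow>\<^sub>E Y" "inj_on f X"
  let ?Rf = "ar R X Y f" and ?Vf = "ar V X Y f"
  have injR: "inj_on ?Rf (ob R X)" and injV: "inj_on ?Vf (ob V X)"
    using R.ar_inj[OF X Y f] V.ar_inj[OF X Y f] .
  show "is_pullback \<U> (ob R X) (ob R Y) (ob V X) (ob V Y) ?Rf (\<tau> X) (\<tau> Y) ?Vf"
    unfolding is_pullback_def
  proof (intro conjI ballI impI)
    show "?Rf \<in> ob R X \<rightarrow>\<^sub>E ob R Y" "?Vf \<in> ob V X \<rightarrow>\<^sub>E ob V Y"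
      using endofunctor_ar[OF R.endofunctor X Y f(1)] endofunctor_ar[OF V.endofunctor X Y f(1)] .
    show "\<tau> X \<in> ob R X \<rightarrow>\<^sub>E ob V X" "\<tau> Y \<in> ob R Y \<rightarrow>\<^sub>E ob V Y"
      using nat_trans_closed[OF natural X] nat_trans_closed[OF natural Y] .
    show "compose (ob R X) (\<tau> Y) ?Rf = compose (ob R X) ?Vf (\<tau> X)"
      using natural X Y f(1) unfolding nat_trans_def by metis
    fix W h k
    assume h: "h \<in> W \<rightarrow>\<^sub>E ob R Y" and k: "k \<in> W \<rightarrow>\<^sub>E ob V X"
      and sq: "compose W (\<tau> Y) h = compose W ?Vf k"
    have hk: "\<tau> Y (h w) = ?Vf (k w)" if "w \<in> W" for w
      using fun_cong[OF sq, of w] that by (simp add: compose_eq)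
    have him: "h w \<in> ?Rf ` ob R X" if w: "w \<in> W" for w
    proof -
      have "R.supp Y (h w) = V.supp Y (?Vf (k w))"
        using supp[OF Y PiE_mem[OF h w]] hk[OF w] by simp
      also have "\<dots> \<subseteq> f ` X"
        using V.in_image_ar_iff_supp[OF X Y f] V.ar_closed[OF X Y f(1)] PiE_mem[OF k w] by blast
      finally show ?thesis using R.in_image_ar_iff_supp[OF X Y f PiE_mem[OF h w]] by blast
    qed
    define m where "m = (\<lambda>w\<in>W. inv_into (ob R X) ?Rf (h w))"
    have m: "m w \<in> ob R X" "?Rf (m w) = h w" if "w \<in> W" for w
      using inv_into_into[OF him[OF that]] f_inv_into_f[OF him[OF that]] that
      unfolding m_def by simp_all
    have \<tau>m: "\<tau> X (m w) = k w" if w: "w \<in> W" for w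
    proof (rule inj_onD[OF injV])
      show "?Vf (\<tau> X (m w)) = ?Vf (k w)"
        using tau_natural[OF X Y f(1) m(1)[OF w]] m(2)[OF w] hk[OF w] by simp
    qed (use tau_mem[OF X m(1)[OF w]] PiE_mem[OF k w] in auto)
    show "\<exists>!m. m \<in> W \<rightarrow>\<^sub>E ob R X \<and> compose W ?Rf m = h \<and> compose W (\<tau> X) m = k"
    proof (rule ex1I[of _ m], intro conjI)
      show "m \<in> W \<rightarrow>\<^sub>E ob R X" using m(1) by (auto simp: m_def)
      show "compose W ?Rf m = h" using h m(2)
        by (intro extensionalityI[of _ W]) (simp_all add: PiE_def compose_extensional compose_eq)
      show "compose W (\<tau> X) m = k" using k \<tau>m
        by (intro extensionalityI[of _ W]) (simp_all add: PiE_def compose_extensional compose_eq)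
      fix m' assume m': "m' \<in> W \<rightarrow>\<^sub>E ob R X \<and> compose W ?Rf m' = h \<and> compose W (\<tau> X) m' = k"
      show "m' = m"
      proof (rule extensionalityI[of _ W])
        fix w assume w: "w \<in> W"
        have "?Rf (m' w) = h w" 
          using m' w by (metis compose_eq)
        then show "m' w = m w"
          using inj_onD[OF injR] m[OF w] PiE_mem[of m' W] m' w by metis
      qed (use m' in \<open>simp_all add: PiE_def m_def\<close>)
    qed
  qed
qed

end


section \<open>Plonka sums\<close>

text \<open>\<open>plonka_gather\<close> is \<open>\<langle>a, z\<rangle> \<mapsto> F(U, a)(z)\<close>, where \<open>U\<close> is the set of all indices occurring in \<open>Z\<close>.\<close>

definition plonka_gather ::
    "('u \<times> 'u \<Rightarrow> 'u) \<Rightarrow> ('u set \<times> 'u \<Rightarrow> 'u \<Rightarrow> 'u) \<Rightarrow> 'u set \<Rightarrow> 'u \<Rightarrow> 'u" where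
  "plonka_gather pr M Z =
     (\<lambda>w\<in>Z. M ((\<lambda>w. fst (inv pr w)) ` Z, fst (inv pr w)) (snd (inv pr w)))"

lemma sup_semilattice_sup_closed:
  assumes "sup_semilattice L" "U \<subseteq> carrier L" "finite U"
  shows "\<Squnion>\<^bsub>L\<^esub>U \<in> carrier L"
proof -
  obtain s where "least L s (Upper L U)" using assms unfolding sup_semilattice_def by blast
  then have "least L (\<Squnion>\<^bsub>L\<^esub>U) (Upper L U)" unfolding sup_def by (rule someI)
  then show ?thesis by (rule least_closed)
qed

context sa_functor
begin

text \<open>
  A representative \<open>(n, x, r)\<close> of \<open>t\<close> over \<open>S\<close> also represents \<open>t0\<close> over the support \<open>Z\<close>,
  and the family \<open>i \<mapsto> F(\<psi>\<^sub>i)(x\<^sub>i)\<close> is the composite of \<open>x\<close> with the gathering map. So all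
  representatives give the same value.
\<close>

lemma plonka_lambda_eq:
  fixes L :: "'u gorder" and K :: "'u \<Rightarrow> 'u set"
  defines "S \<equiv> coprod pr (carrier L) K"
  assumes S: "S \<in> \<U>" and t: "t \<in> ob T S"
    and Z: "Z = supp S t"
    and b: "b = \<Squnion>\<^bsub>L\<^esub>((\<lambda>w. fst (inv pr w)) ` Z)" "K b \<in> \<U>"
    and h: "plonka_gather pr M Z \<in> Z \<rightarrow>\<^sub>E K b"
    and t0: "t0 \<in> ob T Z" "ar T Z S (id_on Z) t0 = t"
  shows "plonka_lambda pr T C \<phi> L K M t = pr (b, ar T Z (K b) (plonka_gather pr M Z) t0)"
proof -
  let ?p = "\<lambda>w. fst (inv pr w)" and ?z = "\<lambda>w. snd (inv pr w)"
  let ?val = "pr (b, ar T Z (K b) (plonka_gather pr M Z) t0)"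
  let ?P = "\<lambda>w n x r. (n, x, r) \<in> sa_pre C S \<and> t = \<phi> S (sa_cls C S n x r) \<and>
     w = pr (\<Squnion>\<^bsub>L\<^esub>((\<lambda>i. ?p (x i)) ` {1..n}),
       sa_elem C \<phi> (K (\<Squnion>\<^bsub>L\<^esub>((\<lambda>i. ?p (x i)) ` {1..n}))) n
         (\<lambda>i\<in>{1..n}. M ((\<lambda>i. ?p (x i)) ` {1..n}, ?p (x i)) (?z (x i))) r)"
  have ZS: "Z \<subseteq> S" "Z \<in> \<U>" using supp_subset[OF S t] subset_closed[OF S] Z by auto
  then have i: "id_on Z \<in> Z \<rightarrow>\<^sub>E S" "inj_on (id_on Z) Z" by auto
  have val: "w = ?val" if P: "?P w n x r" for w n x r
  proof -
    have x: "(n, x, r) \<in> sa_pre C S" and teq: "t = \<phi> S (sa_cls C S n x r)" using P by auto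
    have xZ: "x ` {1..n} = Z" using supp_phi[OF S x] teq Z by simp
    have U: "(\<lambda>i. ?p (x i)) ` {1..n} = ?p ` Z" unfolding xZ[symmetric] by (simp only: image_image)
    have xZ_mem: "x i \<in> Z" if "i \<in> {1..n}" for i using xZ that by blast
    have "x \<in> {1..n} \<rightarrow>\<^sub>E Z"
      using xZ_mem sa_preD(1)[OF x] unfolding PiE_iff by blast
    then have x': "(n, x, r) \<in> sa_pre C Z" using sa_preD(2,3)[OF x] by (rule sa_preI)
    have "compose {1..n} (id_on Z) x = x"
      using xZ_mem sa_preD(1)[OF x] by (intro extensionalityI[of _ "{1..n}"])
        (simp_all only: compose_extensional compose_eq restrict_apply' PiE_iff)
    then have "ar T Z S (id_on Z) (\<phi> Z (sa_cls C Z n x r)) = ar T Z S (id_on Z) t0"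
      unfolding t0(2) ar_phi[OF ZS(2) S i(1) x'] sa_ar_sa_cls_inj(2)[OF x' i] teq by simp
    then have t0_eq: "t0 = \<phi> Z (sa_cls C Z n x r)"
      using inj_onD[OF ar_inj[OF ZS(2) S i]] t0(1) phi_closed[OF ZS(2) x'] by metis
    have "(\<lambda>i\<in>{1..n}. M (?p ` Z, ?p (x i)) (?z (x i))) = compose {1..n} (plonka_gather pr M Z) x"
      by (rule extensionalityI[of _ "{1..n}"])
        (simp_all only: compose_extensional restrict_extensional compose_eq restrict_apply'
          plonka_gather_def xZ_mem)
    then have "sa_elem C \<phi> (K b) n (\<lambda>i\<in>{1..n}. M (?p ` Z, ?p (x i)) (?z (x i))) r =
        ar T Z (K b) (plonka_gather pr M Z) t0"
      unfolding sa_elem_def t0_eq ar_phi[OF ZS(2) b(2) h x'] by (simp only: sa_ar_sa_cls_id[OF x' h])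
    then show ?thesis using P unfolding U b(1)[symmetric] by simp
  qed
  obtain n x r where "(n, x, r) \<in> sa_pre C S" "t = \<phi> S (sa_cls C S n x r)" using obE[OF S t] .
  then obtain w where P: "?P w n x r" by blast
  have "(THE w. \<exists>n x r. ?P w n x r) = ?val"
  proof (rule the_equality)
    show "\<exists>n x r. ?P ?val n x r" using P unfolding val[OF P, symmetric] by (intro exI)
    show "w' = ?val" if "\<exists>n x r. ?P w' n x r" for w' using that by (elim exE) (rule val)
  qed
  then show ?thesis
    using t unfolding plonka_lambda_def Let_def S_def by simp
qed

text \<open>
  The conditions on \<open>F\<close> and \<open>M\<close> concern only underlying sets. They are therefore the same for \<open>F\<close>
  and for the diagram obtained from \<open>F\<close> by \<open>em_map\<close>, and the lemma applies to both.
\<close>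

lemma plonka_sum_apply:
  fixes L :: "'u gorder" and F :: "'u \<Rightarrow> 'u alg"
  defines "S \<equiv> coprod pr (carrier L) (\<lambda>a. fst (F a))"
  assumes L: "sup_semilattice L" "carrier L \<in> \<U>"
    and F: "\<And>a. a \<in> carrier L \<Longrightarrow> fst (F a) \<in> \<U>"
    and M: "\<And>u U. U \<subseteq> carrier L \<Longrightarrow> finite U \<Longrightarrow> u \<in> U \<Longrightarrow>
      M (U, u) \<in> fst (F u) \<rightarrow>\<^sub>E fst (F (\<Squnion>\<^bsub>L\<^esub>U))"
    and t: "t \<in> ob T S" and Z: "Z = supp S t"
    and b: "b = \<Squnion>\<^bsub>L\<^esub>((\<lambda>w. fst (inv pr w)) ` Z)"
    and t0: "t0 \<in> ob T Z" "ar T Z S (id_on Z) t0 = t"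
  shows "b \<in> carrier L"
    and "plonka_gather pr M Z \<in> Z \<rightarrow>\<^sub>E fst (F b)"
    and "snd (plonka_sum pr T C \<phi> L F M) t =
      pr (b, snd (F b) (ar T Z (fst (F b)) (plonka_gather pr M Z) t0))"
proof -
  let ?p = "\<lambda>w. fst (inv pr w)" and ?z = "\<lambda>w. snd (inv pr w)"
  have S: "S \<in> \<U>" unfolding S_def using L(2) F by (rule coprod_in_universe)
  have ZS: "Z \<subseteq> S" "Z \<in> \<U>" "finite Z"
    using supp_subset[OF S t] finite_supp[OF S t] subset_closed[OF S] Z by auto
  have pz: "?p w \<in> carrier L" "?z w \<in> fst (F (?p w))" if "w \<in> Z" for w
  proof -
    have "w \<in> coprod pr (carrier L) (\<lambda>a. fst (F a))" using ZS(1) that unfolding S_def by blast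
    then obtain a z where "a \<in> carrier L" "z \<in> fst (F a)" "w = pr (a, z)" by (rule coprodE)
    then show "?p w \<in> carrier L" "?z w \<in> fst (F (?p w))" by simp_all
  qed
  have U: "?p ` Z \<subseteq> carrier L" "finite (?p ` Z)" using pz(1) ZS(3) by auto
  show bL: "b \<in> carrier L" unfolding b using sup_semilattice_sup_closed[OF L(1) U] .
  have Fb: "fst (F b) \<in> \<U>" using F[OF bL] .
  show h: "plonka_gather pr M Z \<in> Z \<rightarrow>\<^sub>E fst (F b)"
    unfolding plonka_gather_def
  proof (rule restrict_PiE_iff[THEN iffD2], rule ballI)
    fix w assume w: "w \<in> Z"
    show "M (?p ` Z, ?p w) (?z w) \<in> fst (F b)"
      unfolding b using M[OF U imageI[OF w]] pz(2)[OF w] by (rule PiE_mem)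
  qed
  have "plonka_lambda pr T C \<phi> L (\<lambda>a. fst (F a)) M t =
      pr (b, ar T Z (fst (F b)) (plonka_gather pr M Z) t0)"
    using S t Z b Fb h t0 unfolding S_def by (rule plonka_lambda_eq)
  moreover have "ar T Z (fst (F b)) (plonka_gather pr M Z) t0 \<in> ob T (fst (F b))"
    using ar_closed[OF ZS(2) Fb h t0(1)] .
  ultimately show "snd (plonka_sum pr T C \<phi> L F M) t =
      pr (b, snd (F b) (ar T Z (fst (F b)) (plonka_gather pr M Z) t0))"
    using t bL coprod_map_pr[of b "carrier L" _ "\<lambda>a. ob T (fst (F a))"]
    unfolding plonka_sum_def Let_def S_def by (simp add: compose_eq)
qed

text \<open>
  The maps within the summands do not change the index, so that on indices the structure is the
  join of the indices occurring in the support.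
\<close>

lemma plonka_sum_index:
  fixes L :: "'u gorder" and F :: "'u \<Rightarrow> 'u alg"
  defines "S \<equiv> coprod pr (carrier L) (\<lambda>a. fst (F a))"
  assumes L: "sup_semilattice L" "carrier L \<in> \<U>"
    and F: "\<And>a. a \<in> carrier L \<Longrightarrow> fst (F a) \<in> \<U>"
    and M: "\<And>u U. U \<subseteq> carrier L \<Longrightarrow> finite U \<Longrightarrow> u \<in> U \<Longrightarrow>
      M (U, u) \<in> fst (F u) \<rightarrow>\<^sub>E fst (F (\<Squnion>\<^bsub>L\<^esub>U))"
    and t: "t \<in> ob T S"
  shows "fst (inv pr (snd (plonka_sum pr T C \<phi> L F M) t)) =
    \<Squnion>\<^bsub>L\<^esub>((\<lambda>w. fst (inv pr w)) ` supp S t)"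
proof -
  have S: "S \<in> \<U>" unfolding S_def using L(2) F by (rule coprod_in_universe)
  obtain t0 where t0: "t0 \<in> ob T (supp S t)" "ar T (supp S t) S (id_on (supp S t)) t0 = t"
    using restrict_to_supp[OF S t order_refl supp_subset[OF S t]] .
  show ?thesis
    using plonka_sum_apply(3)[where F = F and M = M,
        OF L F M t[unfolded S_def] refl refl t0[unfolded S_def]]
    unfolding S_def by simp
qed

end

lemma cpr_alg_functor_maps:
  assumes "cpr_alg_functor \<U> T L F M" "sup_semilattice L"
    and U: "U \<subseteq> carrier L" "finite U" "u \<in> U"
  shows "M (U, u) \<in> fst (F u) \<rightarrow>\<^sub>E fst (F (\<Squnion>\<^bsub>L\<^esub>U))"
proof -
  have "(U, u) \<in> cpr_hom L u (\<Squnion>\<^bsub>L\<^esub>U)" using U unfolding cpr_hom_def by blast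
  moreover have "\<Squnion>\<^bsub>L\<^esub>U \<in> carrier L" "u \<in> carrier L"
    using sup_semilattice_sup_closed[OF assms(2) U(1,2)] U by auto
  ultimately have "M (U, u) \<in> em_hom T (F u) (F (\<Squnion>\<^bsub>L\<^esub>U))"
    using assms(1) unfolding cpr_alg_functor_def by blast
  then show ?thesis unfolding em_hom_def by (auto split: prod.splits)
qed

lemma cpr_alg_functor_carrier:
  assumes "cpr_alg_functor \<U> T L F M" "a \<in> carrier L"
  shows "fst (F a) \<in> \<U>"
proof -
  have "em_algebra \<U> T (F a)" using assms unfolding cpr_alg_functor_def by blast
  then show ?thesis by (cases "F a") (simp add: em_algebra_def)
qed

lemma fst_em_map: "fst (em_map R \<tau> \<A>) = fst \<A>"
  by (simp add: em_map_def split: prod.splits)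

lemma snd_em_map: "snd (em_map R \<tau> \<A>) = compose (ob R (fst \<A>)) (snd \<A>) (\<tau> (fst \<A>))"
  by (simp add: em_map_def split: prod.splits)

lemma fst_plonka_sum:
  "fst (plonka_sum pr T C \<phi> L F M) = coprod pr (carrier L) (\<lambda>a. fst (F a))"
  by (simp add: plonka_sum_def Let_def)

lemma snd_plonka_sum_extensional:
  "snd (plonka_sum pr T C \<phi> L F M) \<in>
    extensional (ob T (coprod pr (carrier L) (\<lambda>a. fst (F a))))"
  by (simp add: plonka_sum_def Let_def compose_extensional)

context sa_transformation
begin

text \<open>
  The restriction of \<open>\<tau> t\<close> to the common support is \<open>\<tau> t0\<close>, so both structures gather along
  the same map, and naturality of \<open>\<tau>\<close> at this map makes them agree.
\<close>

lemma supp_tau_preserves_plonka_sums: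
  assumes supp: "\<And>X t. X \<in> \<U> \<Longrightarrow> t \<in> ob R X \<Longrightarrow> V.supp X (\<tau> X t) = R.supp X t"
  shows "preserves_plonka_sums \<U> pr R CR \<phi>R V CV \<phi>V \<tau>"
  unfolding preserves_plonka_sums_def
proof (intro allI impI, elim conjE)
  fix L F M
  assume L: "sup_semilattice L" "carrier L \<in> \<U>" and F: "cpr_alg_functor \<U> V L F M"
  let ?S = "coprod pr (carrier L) (\<lambda>a. fst (F a))"
  let ?PR = "plonka_sum pr R CR \<phi>R L (\<lambda>a. em_map R \<tau> (F a)) M"
  let ?PV = "plonka_sum pr V CV \<phi>V L F M"
  note maps = cpr_alg_functor_maps[OF F L(1)] and small = cpr_alg_functor_carrier[OF F]
  have S: "?S \<in> \<U>" using L(2) small by (rule R.coprod_in_universe)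
  have "snd ?PR = compose (ob R ?S) (snd ?PV) (\<tau> ?S)"
  proof (rule extensionalityI)
    fix t assume t: "t \<in> ob R ?S"
    define Z where "Z = R.supp ?S t"
    have Z: "Z \<subseteq> ?S" "Z \<in> \<U>" using R.supp_subset[OF S t] R.subset_closed[OF S] Z_def by auto
    then have i: "id_on Z \<in> Z \<rightarrow>\<^sub>E ?S" by auto
    obtain t0 where t0: "t0 \<in> ob R Z" "ar R Z ?S (id_on Z) t0 = t"
      using R.restrict_to_supp[OF S t _ Z(1)] Z_def by blast
    define b where "b = \<Squnion>\<^bsub>L\<^esub>((\<lambda>w. fst (inv pr w)) ` Z)"
    let ?h = "plonka_gather pr M Z"
    have \<tau>t: "\<tau> ?S t \<in> ob V ?S" "Z = V.supp ?S (\<tau> ?S t)"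
      using tau_mem[OF S t] supp[OF S t] Z_def by auto
    have \<tau>t0: "\<tau> Z t0 \<in> ob V Z" "ar V Z ?S (id_on Z) (\<tau> Z t0) = \<tau> ?S t"
      using tau_mem[OF Z(2) t0(1)] tau_natural[OF Z(2) S i t0(1)] t0(2) by auto
    note PV = V.plonka_sum_apply[OF L small maps \<tau>t b_def \<tau>t0]
    have Fb: "fst (F b) \<in> \<U>" using small PV(1) by blast
    have "snd ?PR t = pr (b, snd (em_map R \<tau> (F b)) (ar R Z (fst (F b)) ?h t0))"
      using R.plonka_sum_apply(3)[where F = "\<lambda>a. em_map R \<tau> (F a)" and M = M,
          unfolded fst_em_map, OF L small maps t Z_def b_def t0] .
    also have "\<dots> = pr (b, snd (F b) (\<tau> (fst (F b)) (ar R Z (fst (F b)) ?h t0)))"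
      using R.ar_closed[OF Z(2) Fb PV(2) t0(1)] by (simp add: snd_em_map compose_eq)
    also have "\<dots> = pr (b, snd (F b) (ar V Z (fst (F b)) ?h (\<tau> Z t0)))"
      using tau_natural[OF Z(2) Fb PV(2) t0(1)] by simp
    also have "\<dots> = snd ?PV (\<tau> ?S t)" using PV(3) by simp
    finally show "snd ?PR t = compose (ob R ?S) (snd ?PV) (\<tau> ?S) t" using t by (simp add: compose_eq)
  next
    show "snd ?PR \<in> extensional (ob R ?S)"
      using snd_plonka_sum_extensional[where F = "\<lambda>a. em_map R \<tau> (F a)"] by (simp add: fst_em_map)
  qed (rule compose_extensional)
  then show "?PR = em_map R \<tau> ?PV"
    by (intro prod_eqI) (simp_all add: fst_em_map snd_em_map fst_plonka_sum)
qed

end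

section \<open>Plonka sums over the two-element chain\<close>

definition two_chain :: "'a \<Rightarrow> 'a \<Rightarrow> 'a gorder" where
  "two_chain a0 a1 = \<lparr>carrier = {a0, a1}, eq = (=), le = (\<lambda>x y. x = y \<or> x = a0)\<rparr>"

lemma two_chain_partial_order:
  assumes "a0 \<noteq> a1"
  shows "partial_order (two_chain a0 a1)"
  by unfold_locales (use assms in \<open>auto simp: two_chain_def\<close>)

lemma two_chain_least:
  assumes "a0 \<noteq> a1" "U \<subseteq> {a0, a1}"
  shows "least (two_chain a0 a1) (if a1 \<in> U then a1 else a0) (Upper (two_chain a0 a1) U)"
  using assms by (auto simp: least_def Upper_def two_chain_def)

text \<open>
  By this formula, the Plonka sum of one-point algebras over the chain records whether the top
  occurs in the support. The empty join is the bottom \<open>a0\<close>.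
\<close>

lemma two_chain_sup:
  assumes "a0 \<noteq> a1" "U \<subseteq> {a0, a1}"
  shows "\<Squnion>\<^bsub>two_chain a0 a1\<^esub>U = (if a1 \<in> U then a1 else a0)"
proof -
  interpret partial_order "two_chain a0 a1" using assms(1) by (rule two_chain_partial_order)
  show ?thesis
    unfolding sup_def using two_chain_least[OF assms] by (intro some_equality) (blast intro: least_unique)+
qed

lemma two_chain_sup_semilattice:
  assumes "a0 \<noteq> a1"
  shows "sup_semilattice (two_chain a0 a1)"
  unfolding sup_semilattice_def
  using two_chain_partial_order[OF assms] two_chain_least[OF assms]
  by (auto simp: two_chain_def)

definition point_algebra :: "('u, 'm) monad_scheme \<Rightarrow> 'u \<Rightarrow> 'u alg" where
  "point_algebra T c = ({c}, \<lambda>_\<in>ob T {c}. c)"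

text \<open>
  Every equation to be checked is between maps into \<open>{c}\<close>. What remains is that these maps are
  defined on the same set, for which the unit and the multiplication must have their values in
  \<open>T {c}\<close>, where the structure map is not \<open>undefined\<close>.
\<close>

lemma point_functor:
  assumes T: "is_monad \<U> T" and c: "{c} \<in> \<U>"
  shows "cpr_alg_functor \<U> T L (\<lambda>_. point_algebra T c) (\<lambda>_. id_on {c})"
proof -
  let ?\<beta> = "\<lambda>_\<in>ob T {c}. c"
  have ef: "endofunctor \<U> T" and \<eta>: "nat_trans \<U> id_fun T (eta T)"
    and \<mu>: "nat_trans \<U> (comp_fun T T) T (mu T)"
    using T unfolding is_monad_def by auto
  have Tc: "ob T {c} \<in> \<U>" using ef c unfolding endofunctor_def by blast
  have \<beta>: "?\<beta> \<in> ob T {c} \<rightarrow>\<^sub>E {c}" by auto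
  have \<eta>c: "eta T {c} c \<in> ob T {c}"
    using nat_trans_closed[OF \<eta> c] by (auto simp: id_fun_def)
  have \<mu>c: "mu T {c} w \<in> ob T {c}" if "w \<in> ob T (ob T {c})" for w
    using nat_trans_closed[OF \<mu> c] that by (auto simp: comp_fun_def)
  have T\<beta>: "ar T (ob T {c}) {c} ?\<beta> w \<in> ob T {c}" if "w \<in> ob T (ob T {c})" for w
    using endofunctor_ar[OF ef Tc c \<beta>] that by auto
  have Tid: "ar T {c} {c} (id_on {c}) = id_on (ob T {c})"
    using ef c unfolding endofunctor_def by blast
  have alg: "em_algebra \<U> T (point_algebra T c)"
    unfolding em_algebra_def point_algebra_def prod.case
  proof (intro conjI c \<beta>)
    show "compose {c} ?\<beta> (eta T {c}) = id_on {c}"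
      using \<eta>c by (auto simp: compose_def fun_eq_iff)
    show "compose (ob T (ob T {c})) ?\<beta> (mu T {c}) =
        compose (ob T (ob T {c})) ?\<beta> (ar T (ob T {c}) {c} ?\<beta>)"
    proof (rule extensionalityI)
      fix w assume w: "w \<in> ob T (ob T {c})"
      show "compose (ob T (ob T {c})) ?\<beta> (mu T {c}) w =
          compose (ob T (ob T {c})) ?\<beta> (ar T (ob T {c}) {c} ?\<beta>) w"
        unfolding compose_eq[OF w] using \<mu>c[OF w] T\<beta>[OF w] by (simp only: restrict_apply')
    qed (rule compose_extensional)+
  qed
  have hom: "id_on {c} \<in> em_hom T (point_algebra T c) (point_algebra T c)"
    unfolding em_hom_def point_algebra_def prod.case mem_Collect_eq Tid
    by (auto simp: compose_def fun_eq_iff)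
  have "compose {c} (id_on {c}) (id_on {c}) = id_on {c}"
    by (auto simp: compose_def fun_eq_iff)
  then show ?thesis
    unfolding cpr_alg_functor_def using alg hom by (simp add: point_algebra_def)
qed

context sa_transformation
begin

text \<open>
  If \<open>z\<close> is in the support of \<open>t\<close> but not in that of \<open>\<tau> t\<close>, the map \<open>g\<close> that marks \<open>z\<close> by the
  top \<open>a1\<close> and all other elements by the bottom \<open>a0\<close> transports this difference to a difference
  between joins.
\<close>

lemma preserves_plonka_sums_supp_tau:
  assumes V: "is_monad \<U> V"
    and pres: "preserves_plonka_sums \<U> pr R CR \<phi>R V CV \<phi>V \<tau>"
    and X: "X \<in> \<U>" and t: "t \<in> ob R X"
  shows "R.supp X t \<subseteq> V.supp X (\<tau> X t)"
proof
  fix z assume z: "z \<in> R.supp X t"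
  show "z \<in> V.supp X (\<tau> X t)"
  proof (rule ccontr)
    assume zn: "z \<notin> V.supp X (\<tau> X t)"
    obtain a0 a1 :: 'u where ne: "a0 \<noteq> a1"
    proof -
      obtain I :: "'u set" where I: "infinite I" using R.infinity by blast
      obtain a0 where "a0 \<in> I" using infinite_imp_nonempty[OF I] by blast
      moreover obtain a1 where "a1 \<in> I - {a0}"
        using infinite_imp_nonempty[OF infinite_remove[OF I, of a0]] by blast
      ultimately show ?thesis using that by blast
    qed
    let ?L = "two_chain a0 a1" and ?F = "\<lambda>_::'u. point_algebra V a0"
      and ?M = "\<lambda>_::'u set \<times> 'u. id_on {a0}"
    let ?S = "coprod pr (carrier ?L) (\<lambda>a. fst (?F a))"
    let ?p = "\<lambda>w. fst (inv pr w)"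
    have L: "sup_semilattice ?L" "carrier ?L \<in> \<U>"
      using two_chain_sup_semilattice[OF ne] R.finite_in_universe by (auto simp: two_chain_def)
    have pt: "{a0} \<in> \<U>" by (rule R.finite_in_universe) simp
    have F: "cpr_alg_functor \<U> V ?L ?F ?M" using V pt by (rule point_functor)
    note maps = cpr_alg_functor_maps[OF F L(1)] and small = cpr_alg_functor_carrier[OF F]
    have S: "?S \<in> \<U>" using L(2) small by (rule R.coprod_in_universe)
    \<comment> \<open>The second component is the only point of the algebra, which happens to be \<open>a0\<close> as well.\<close>
    define g where "g = (\<lambda>w\<in>X. pr (if w = z then a1 else a0, a0))"
    have g: "g \<in> X \<rightarrow>\<^sub>E ?S"
      unfolding g_def
      by (auto intro!: R.pr_in_coprod simp: two_chain_def point_algebra_def)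
    define u where "u = ar R X ?S g t"
    have u: "u \<in> ob R ?S" unfolding u_def by (rule R.ar_closed[OF X S g t])
    have suppR: "R.supp ?S u = g ` R.supp X t"
      unfolding u_def by (rule R.supp_ar[OF X S g t])
    have "\<tau> ?S u = ar V X ?S g (\<tau> X t)"
      unfolding u_def using tau_natural[OF X S g t] by simp
    then have suppV: "V.supp ?S (\<tau> ?S u) = g ` V.supp X (\<tau> X t)"
      using V.supp_ar[OF X S g tau_mem[OF X t]] by simp
    have zX: "z \<in> X" using z R.supp_subset[OF X t] by blast
    have pR: "?p ` R.supp ?S u \<subseteq> {a0, a1}" "a1 \<in> ?p ` R.supp ?S u"
    proof -
      show "?p ` R.supp ?S u \<subseteq> {a0, a1}"
        unfolding suppR g_def using R.supp_subset[OF X t] by auto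
      have "?p (g z) = a1" unfolding g_def using zX by simp
      then show "a1 \<in> ?p ` R.supp ?S u" unfolding suppR using z by force
    qed
    have "?p ` V.supp ?S (\<tau> ?S u) \<subseteq> {a0}"
      unfolding suppV g_def using V.supp_subset[OF X tau_mem[OF X t]] zn by auto
    then have pV: "?p ` V.supp ?S (\<tau> ?S u) \<subseteq> {a0, a1}" "a1 \<notin> ?p ` V.supp ?S (\<tau> ?S u)"
      using ne by blast+
    note \<tau>u = tau_mem[OF S u]
    have "?p (snd (plonka_sum pr R CR \<phi>R ?L (\<lambda>a. em_map R \<tau> (?F a)) ?M) u) =
        \<Squnion>\<^bsub>?L\<^esub>(?p ` R.supp ?S u)"
      using R.plonka_sum_index[where F = "\<lambda>a. em_map R \<tau> (?F a)" and M = ?M,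
          unfolded fst_em_map, OF L small maps u] .
    also have "\<dots> = a1" using two_chain_sup[OF ne pR(1)] pR(2) by simp
    finally have R1: "?p (snd (plonka_sum pr R CR \<phi>R ?L (\<lambda>a. em_map R \<tau> (?F a)) ?M) u) = a1" .
    have "?p (snd (plonka_sum pr V CV \<phi>V ?L ?F ?M) (\<tau> ?S u)) =
        \<Squnion>\<^bsub>?L\<^esub>(?p ` V.supp ?S (\<tau> ?S u))"
      using V.plonka_sum_index[where F = ?F and M = ?M, OF L small maps \<tau>u] .
    also have "\<dots> = a0" unfolding two_chain_sup[OF ne pV(1)] using pV(2) by (rule if_not_P)
    finally have V0: "?p (snd (plonka_sum pr V CV \<phi>V ?L ?F ?M) (\<tau> ?S u)) = a0" .
    have "plonka_sum pr R CR \<phi>R ?L (\<lambda>a. em_map R \<tau> (?F a)) ?M =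
        em_map R \<tau> (plonka_sum pr V CV \<phi>V ?L ?F ?M)"
      using pres L F unfolding preserves_plonka_sums_def by blast
    then have "snd (plonka_sum pr R CR \<phi>R ?L (\<lambda>a. em_map R \<tau> (?F a)) ?M) u =
        snd (plonka_sum pr V CV \<phi>V ?L ?F ?M) (\<tau> ?S u)"
      using u by (simp add: snd_em_map fst_plonka_sum compose_eq)
    then show False using R1 V0 ne by simp
  qed
qed

end

section \<open>Semi-cartesian morphisms and preservation of Plonka sums\<close>

theorem theorem5p5:
  fixes \<U> :: "'u set set" and pr :: "'u \<times> 'u \<Rightarrow> 'u"
    and \<R> \<V> :: "'u monad"
    and CR CV :: "'u coeff"
    and \<phi>R \<phi>V :: "'u set \<Rightarrow> ('u, 'u) sa_rep set \<Rightarrow> 'u"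
    and \<tau> :: "'u set \<Rightarrow> 'u \<Rightarrow> 'u"
  assumes "set_universe \<U> pr"
    and "semi_analytic_monad \<U> \<R> CR \<phi>R"
    and "semi_analytic_monad \<U> \<V> CV \<phi>V"
    and "monad_morphism \<U> \<R> \<V> \<tau>"
  shows "semi_cartesian \<U> \<R> \<V> \<tau> \<longleftrightarrow>
         preserves_plonka_sums \<U> pr \<R> CR \<phi>R \<V> CV \<phi>V \<tau>"
proof -
  have sa: "sa_functor \<U> pr C T \<phi>" if "semi_analytic_monad \<U> T C \<phi>"
    for T :: "'u monad" and C \<phi>
    using that assms(1)
    unfolding semi_analytic_monad_def is_monad_def sa_presentation_def sa_functor_def
      sa_functor_axioms_def coefficients_def by blast
  interpret sa_transformation \<U> pr CR \<R> \<phi>R CV \<V> \<phi>V \<tau>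
    using sa[OF assms(2)] sa[OF assms(3)] assms(4)
    unfolding sa_transformation_def sa_transformation_axioms_def monad_morphism_def by blast
  have V: "is_monad \<U> \<V>" using assms(3) unfolding semi_analytic_monad_def by blast
  show ?thesis
  proof
    assume "semi_cartesian \<U> \<R> \<V> \<tau>"
    then show "preserves_plonka_sums \<U> pr \<R> CR \<phi>R \<V> CV \<phi>V \<tau>"
      using semi_cartesian_supp_tau supp_tau_subset
      by (intro supp_tau_preserves_plonka_sums subset_antisym)
  next
    assume "preserves_plonka_sums \<U> pr \<R> CR \<phi>R \<V> CV \<phi>V \<tau>"
    then show "semi_cartesian \<U> \<R> \<V> \<tau>"
      using preserves_plonka_sums_supp_tau[OF V] supp_tau_subset
      by (intro supp_tau_semi_cartesian subset_antisym)
  qed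
qed

end
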